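(* Let $\Sigma=(\mathbf{x},\mathbf{F})$ be an LP seed of rank $n$ with $\hat F_j=F_j$ for all $j\in[1,n]$, and let $\Sigma'=\mu_k(\Sigma)$ for some $k\in[1,n]$. Then $\mathcal{U}(\Sigma)=\mathcal{U}(\Sigma')$.
   Context: $R$ is a unique factorization domain containing $\mathbb{Z}$ and $\mathcal{F}$ is the field of rational functions in $n$ variables over $\mathrm{Frac}(R)$. For a rational function $F$, write $x_i\in F$ if $F$ involves $x_i$. An LP seed of rank $n$ is a pair $(\mathbf{x},\mathbf{F})$ where $\mathbf{x}=\{x_1,\dots,x_n\}$ is a transcendence basis of $\mathcal{F}$ over $\mathrm{Frac}(R)$ and $\mathbf{F}=\{F_1,\dots,F_n\}$ are irreducible polynomials in $R[x_1,\dots,x_n]$ with $x_j\nmid F_i$ for all $i,j$ and $F_i$ not involving $x_i$. The exchange Laurent polynomial is $\hat F_j=F_j/\prod_{k\neq j}x_k^{a_k}$, with $a_k\in\mathbb{Z}_{\ge0}$ maximal such that $F_k^{a_k}$ divides $F_j|_{x_k\leftarrow F_k/x'_k}$ in $R[x_1,\dots,x_{k-1},(x'_k)^{-1},x_{k+1},\dots,x_n]$. LP mutation in direction $k$: $\mu_k(\mathbf{x},\mathbf{F})=(\mathbf{x}',\mathbf{F}')$ with $x'_k=\hat F_k/x_k$, $x'_i=x_i$ ($i\ne k$); $F'_k=F_k$; if $x_k\notin F_i$ then $F'_i=F_i$ (up to a unit); if $x_k\in F_i$, put $N_k=(\hat F_k|_{x_i\leftarrow0})/x'_k$, $G_i=F_i|_{x_k\leftarrow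 N_k}$, let $H_i$ be $G_i$ with all common factors (in $R[x_1,\dots,\widehat{x_i},\dots,\widehat{x_k},\dots,x_n]$) with $\hat F_k|_{x_i\leftarrow0}$ removed, and $F'_i=MH_i$ with $M$ a Laurent monomial in $\{x'_j\}_{j\ne i}$ with unit coefficient such that $F'_i\in R[x'_1,\dots,x'_n]$ is not divisible by any $x'_j$. The result is an LP seed. For an LP seed $\Sigma=(\mathbf{x},\mathbf{F})$ set $x'_j=\hat F_j/x_j$ and $\mathbf{x}_j=(\mathbf{x}\setminus\{x_j\})\cup\{x'_j\}$; the upper bound is $\mathcal{U}(\Sigma)=R[\mathbf{x}^{\pm1}]\cap R[\mathbf{x}_1^{\pm1}]\cap\dots\cap R[\mathbf{x}_n^{\pm1}]\subseteq\mathcal{F}$. *)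

theory Defs
  imports "HOL-Library.Poly_Mapping" "HOL-Computational_Algebra.Factorial_Ring"
begin

type_synonym 'a mpoly = "(nat \<Rightarrow>\<^sub>0 nat) \<Rightarrow>\<^sub>0 'a"

definition Var :: "nat \<Rightarrow> 'a::{zero,one} mpoly" where
  "Var i = Poly_Mapping.single (Poly_Mapping.single i 1) 1"

definition Const :: "'a::zero \<Rightarrow> 'a mpoly" where
  "Const c = Poly_Mapping.single 0 c"

definition vars :: "'a::zero mpoly \<Rightarrow> nat set" where
  "vars p = (\<Union>m\<in>Poly_Mapping.keys p. Poly_Mapping.keys m)"

definition meval :: "('a::zero \<Rightarrow> 'b::comm_semiring_1) \<Rightarrow> (nat \<Rightarrow> 'b) \<Rightarrow> 'a mpoly \<Rightarrow> 'b" where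
  "meval h v p = (\<Sum>m\<in>Poly_Mapping.keys p.
       h (Poly_Mapping.lookup p m) * (\<Prod>i\<in>Poly_Mapping.keys m. v i ^ Poly_Mapping.lookup m i))"

definition ring_emb :: "('a::comm_ring_1 \<Rightarrow> 'k::field) \<Rightarrow> bool" where
  "ring_emb emb \<longleftrightarrow> emb 0 = 0 \<and> emb 1 = 1 \<and> (\<forall>a b. emb (a + b) = emb a + emb b)
      \<and> (\<forall>a b. emb (a * b) = emb a * emb b) \<and> inj emb"

text \<open>x_0..x_{n-1} algebraically independent over R (equivalently over Frac R).\<close>
definition alg_indep :: "('a::comm_ring_1 \<Rightarrow> 'k::field) \<Rightarrow> nat \<Rightarrow> (nat \<Rightarrow> 'k) \<Rightarrow> bool" where
  "alg_indep emb n x \<longleftrightarrow> (\<forall>p. vars p \<subseteq> {..<n} \<longrightarrow> meval emb x p = 0 \<longrightarrow> p = 0)"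

definition rational_function_field :: "('a::comm_ring_1 \<Rightarrow> 'k::field) \<Rightarrow> nat \<Rightarrow> bool" where
  "rational_function_field emb n \<longleftrightarrow> (\<exists>t. alg_indep emb n t \<and>
     (\<forall>y::'k. \<exists>p q. vars p \<subseteq> {..<n} \<and> vars q \<subseteq> {..<n} \<and> meval emb t q \<noteq> 0
                \<and> y = meval emb t p / meval emb t q))"

definition transcendence_basis :: "('a::comm_ring_1 \<Rightarrow> 'k::field) \<Rightarrow> nat \<Rightarrow> (nat \<Rightarrow> 'k) \<Rightarrow> bool" where
  "transcendence_basis emb n x \<longleftrightarrow> alg_indep emb n x \<and>
     (\<forall>y::'k. \<exists>p. p \<noteq> 0 \<and> vars p \<subseteq> {..n} \<and> meval emb (x(n := y)) p = 0)"

definition polyring :: "('a::comm_ring_1 \<Rightarrow> 'k::field) \<Rightarrow> nat set \<Rightarrow> (nat \<Rightarrow> 'k) \<Rightarrow> 'k set" where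
  "polyring emb S x = {meval emb x p | p. vars p \<subseteq> S}"

definition laurent :: "('a::comm_ring_1 \<Rightarrow> 'k::field) \<Rightarrow> nat set \<Rightarrow> (nat \<Rightarrow> 'k) \<Rightarrow> 'k set" where
  "laurent emb S x = {meval emb x p / (\<Prod>j\<in>S. x j ^ e j) | p e. vars p \<subseteq> S}"

definition sdvd :: "'k::field set \<Rightarrow> 'k \<Rightarrow> 'k \<Rightarrow> bool" where
  "sdvd S a b \<longleftrightarrow> (\<exists>c\<in>S. b = a * c)"

definition sunit :: "'k::field set \<Rightarrow> 'k \<Rightarrow> bool" where
  "sunit S a \<longleftrightarrow> a \<in> S \<and> sdvd S a 1"

definition sirred :: "'k::field set \<Rightarrow> 'k \<Rightarrow> bool" where
  "sirred S q \<longleftrightarrow> q \<in> S \<and> q \<noteq> 0 \<and> \<not> sunit S q \<and>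
     (\<forall>a\<in>S. \<forall>b\<in>S. q = a * b \<longrightarrow> sunit S a \<or> sunit S b)"

definition LP_seed :: "('a::comm_ring_1 \<Rightarrow> 'k::field) \<Rightarrow> nat \<Rightarrow> (nat \<Rightarrow> 'k) \<Rightarrow> (nat \<Rightarrow> 'a mpoly) \<Rightarrow> bool" where
  "LP_seed emb n x F \<longleftrightarrow> transcendence_basis emb n x \<and>
     (\<forall>i<n. vars (F i) \<subseteq> {..<n} \<and> irreducible (F i) \<and> i \<notin> vars (F i)
            \<and> (\<forall>j. \<not> Var j dvd F i))"

text \<open>Exponent a_k of x_k in the denominator of \<hat>F_j: the largest a with
  F_k^a dividing F_j|_{x_k \<leftarrow> F_k/x'_k} in R[x_1,..,(x'_k)^{-1},..,x_n].
  The variable X_k is reused for (x'_k)^{-1} (F_k does not involve X_k).\<close>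
definition hat_exp :: "(nat \<Rightarrow> 'a::comm_ring_1 mpoly) \<Rightarrow> nat \<Rightarrow> nat \<Rightarrow> nat" where
  "hat_exp F j k = (GREATEST a. F k ^ a dvd
      meval Const (\<lambda>l. if l = k then F k * Var k else Var l) (F j))"

definition hatF :: "('a::comm_ring_1 \<Rightarrow> 'k::field) \<Rightarrow> nat \<Rightarrow> (nat \<Rightarrow> 'k) \<Rightarrow> (nat \<Rightarrow> 'a mpoly) \<Rightarrow> nat \<Rightarrow> 'k" where
  "hatF emb n x F j = meval emb x (F j) / (\<Prod>k\<in>{..<n} - {j}. x k ^ hat_exp F j k)"

definition upper_bound :: "('a::comm_ring_1 \<Rightarrow> 'k::field) \<Rightarrow> nat \<Rightarrow> (nat \<Rightarrow> 'k) \<Rightarrow> (nat \<Rightarrow> 'a mpoly) \<Rightarrow> 'k set" where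
  "upper_bound emb n x F = laurent emb {..<n} x \<inter>
     (\<Inter>j\<in>{..<n}. laurent emb {..<n} (x(j := hatF emb n x F j / x j)))"

section \<open>LP mutation (as a relation; F'_i is only determined up to units)\<close>

text \<open>Condition on F'_i (i \<noteq> k, x_k \<in> F_i): with P = \<hat>F_k|_{x_i\<leftarrow>0}, N_k = P/x'_k,
  G_i = F_i|_{x_k\<leftarrow>N_k}, A = R[x_j : j \<notin> {i,k}]: G_i = H_i D with D \<in> A consisting only
  of common (irreducible, in A) factors with P, H_i having no such factor left,
  and F'_i = M H_i for a Laurent monomial M in x'_j (j\<noteq>i) with unit coefficient,
  F'_i \<in> R[x'] not divisible by any x'_j.\<close>
definition mut_poly :: "('a::comm_ring_1 \<Rightarrow> 'k::field) \<Rightarrow> nat \<Rightarrow> nat \<Rightarrow> nat \<Rightarrow> (nat \<Rightarrow> 'k)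
    \<Rightarrow> (nat \<Rightarrow> 'a mpoly) \<Rightarrow> (nat \<Rightarrow> 'k) \<Rightarrow> 'a mpoly \<Rightarrow> bool" where
  "mut_poly emb n k i x F x' Fi' \<longleftrightarrow>
    (let P0 = meval emb (x(i := 0)) (F k);
         P = P0 / (\<Prod>j\<in>{..<n} - {i, k}. x j ^ hat_exp F k j);
         N = P / x' k;
         G = meval emb (x(k := N)) (F i);
         A = polyring emb ({..<n} - {i, k}) x;
         PX' = polyring emb {..<n} x'
     in vars Fi' \<subseteq> {..<n} \<and> (\<forall>j. \<not> Var j dvd Fi') \<and>
        (\<exists>D u e. D \<in> A \<and> D \<noteq> 0 \<and> (\<forall>q. sirred A q \<longrightarrow> sdvd A q D \<longrightarrow> sdvd A q P0) \<and>
           u dvd 1 \<and>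
           meval emb x' Fi' * D = emb u * (\<Prod>j\<in>{..<n} - {i}. x' j powi e j) * G) \<and>
        (\<forall>q. sirred A q \<longrightarrow> sdvd A q P0 \<longrightarrow> \<not> sdvd PX' q (meval emb x' Fi')))"

definition LP_mutation :: "('a::comm_ring_1 \<Rightarrow> 'k::field) \<Rightarrow> nat \<Rightarrow> nat \<Rightarrow> (nat \<Rightarrow> 'k)
    \<Rightarrow> (nat \<Rightarrow> 'a mpoly) \<Rightarrow> (nat \<Rightarrow> 'k) \<Rightarrow> (nat \<Rightarrow> 'a mpoly) \<Rightarrow> bool" where
  "LP_mutation emb n k x F x' F' \<longleftrightarrow> k < n \<and>
     x' = x(k := hatF emb n x F k / x k) \<and>
     F' k = F k \<and>
     (\<forall>i<n. i \<noteq> k \<longrightarrow> k \<notin> vars (F i) \<longrightarrow> (\<exists>u. u dvd 1 \<and> F' i = Const u * F i)) \<and>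
     (\<forall>i<n. i \<noteq> k \<longrightarrow> k \<in> vars (F i) \<longrightarrow> mut_poly emb n k i x F x' (F' i))"

end

theory Submission
  imports Defs "HOL-Computational_Algebra.Polynomial"
begin

text \<open>
  All Laurent rings contain the inverses of the other cluster variables, so the denominators of the
  exchange Laurent polynomials of the mutated seed do not matter, and both upper bounds are
  contained in \<open>R[x\<^sup>\<plusminus>] \<inter> R[x'\<^sup>\<plusminus>]\<close>. It remains to compare, for \<open>j \<noteq> k\<close>, the Laurent rings of the two
  clusters in which \<open>x\<^sub>j\<close> is exchanged.

  Write \<open>P = F\<^sub>k\<close>, \<open>Q = F\<^sub>j\<close>, \<open>Q' = F'\<^sub>j\<close>. An element \<open>f/x\<^sub>j\<^sup>L\<close> with \<open>f\<close> polynomial in \<open>x\<^sub>j\<close> lies in the ring with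
  \<open>x\<^sub>j\<close> replaced by \<open>Q/x\<^sub>j\<close> iff \<open>f \<in> (Q, x\<^sub>j)\<^sup>L\<close>; hence elements coprime to \<open>Q\<close> modulo \<open>x\<^sub>j\<close> can be
  cancelled. Modulo \<open>x\<^sub>j\<close> the relation \<open>x\<^sub>k x'\<^sub>k = P\<close> turns \<open>x\<^sub>k\<close> into \<open>P(x\<^sub>j = 0)/x'\<^sub>k\<close> and therefore \<open>Q\<close> into \<open>Q' D\<close> up to
  a unit, where \<open>D\<close> is the factor removed by the mutation. So each of the two rings contains the
  generators of the other after inverting \<open>P\<close> and \<open>D\<close>. These can be cancelled: \<open>Q\<close> does not divide
  \<open>P(x\<^sub>j = 0)\<close> because \<open>F\<^sub>k\<close> has trivial denominator, \<open>Q\<close> does not divide \<open>D\<close> because \<open>D\<close> does not involve \<open>x\<^sub>k\<close>, and \<open>Q'\<close> is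
  coprime to \<open>P(x\<^sub>j = 0)\<close> by construction. The coprimality arguments take place in \<open>R[x]\<close>, which is
  factorial by Gauss.
\<close>

section \<open>Ring homomorphisms, subrings and polynomial evaluation\<close>

text \<open>Besides embeddings into fields this covers \<open>Const\<close>, \<open>as_poly\<close>
  and evaluation of univariate polynomials, whose targets are only rings.\<close>

definition ring_hom :: "('a::comm_ring_1 \<Rightarrow> 'b::comm_ring_1) \<Rightarrow> bool" where
  "ring_hom h \<longleftrightarrow> h 1 = 1 \<and> (\<forall>a b. h (a + b) = h a + h b) \<and> (\<forall>a b. h (a * b) = h a * h b)"

lemma ring_homD:
  assumes "ring_hom h"
  shows "h 0 = 0" "h 1 = 1" "h (a + b) = h a + h b" "h (a * b) = h a * h b"
    "h (- a) = - h a" "h (a - b) = h a - h b" "h (a ^ m) = h a ^ m"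
proof -
  have add: "h (a + b) = h a + h b" and mult: "h (a * b) = h a * h b" and one: "h 1 = 1" for a b
    using assms by (auto simp: ring_hom_def)
  show zero: "h 0 = 0"
    using add[of 0 0] by simp
  show minus: "h (- a) = - h a"
    using add[of a "- a"] zero by (simp add: eq_neg_iff_add_eq_0 add.commute)
  show "h (a - b) = h a - h b"
    using add[of a "- b"] add[of b "- b"] zero by (simp add: eq_neg_iff_add_eq_0 add.commute)
  show "h (a ^ m) = h a ^ m"
    by (induction m) (auto simp: one mult)
qed (use assms in \<open>auto simp: ring_hom_def\<close>)

lemma ring_hom_sum: "ring_hom h \<Longrightarrow> h (sum f I) = (\<Sum>i\<in>I. h (f i))"
  by (induction I rule: infinite_finite_induct) (auto simp: ring_homD)

lemma ring_hom_prod: "ring_hom h \<Longrightarrow> h (prod f I) = (\<Prod>i\<in>I. h (f i))"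
  by (induction I rule: infinite_finite_induct) (auto simp: ring_homD)

lemma ring_hom_comp: "ring_hom g \<Longrightarrow> ring_hom h \<Longrightarrow> ring_hom (g \<circ> h)"
  by (auto simp: ring_hom_def)

lemma ring_hom_dvd: "ring_hom h \<Longrightarrow> a dvd b \<Longrightarrow> h a dvd h b"
  by (auto simp: ring_homD elim!: dvdE)

definition is_subring :: "'b::comm_ring_1 set \<Rightarrow> bool" where
  "is_subring B \<longleftrightarrow> 1 \<in> B \<and> (\<forall>a\<in>B. \<forall>b\<in>B. a - b \<in> B \<and> a * b \<in> B)"

lemma is_subringD:
  assumes "is_subring B"
  shows "0 \<in> B" "1 \<in> B" "a \<in> B \<Longrightarrow> b \<in> B \<Longrightarrow> a + b \<in> B" "a \<in> B \<Longrightarrow> - a \<in> B"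
    "a \<in> B \<Longrightarrow> b \<in> B \<Longrightarrow> a - b \<in> B" "a \<in> B \<Longrightarrow> b \<in> B \<Longrightarrow> a * b \<in> B" "a \<in> B \<Longrightarrow> a ^ m \<in> B"
proof -
  have one: "1 \<in> B" and diff: "a - b \<in> B" and mult: "a * b \<in> B" if "a \<in> B" "b \<in> B" for a b
    using assms that by (auto simp: is_subring_def)
  show zero: "0 \<in> B"
    using assms by (auto simp: is_subring_def dest!: bspec[of _ _ 1])
  show uminus: "- a \<in> B" if "a \<in> B" for a
    using diff[OF zero that] by simp
  show "a + b \<in> B" if "a \<in> B" "b \<in> B"
    using diff[OF that(1) uminus[OF that(2)]] by simp
  show "a ^ m \<in> B" if "a \<in> B"
    by (induction m) (use assms that in \<open>auto simp: is_subring_def\<close>)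
qed (use assms in \<open>auto simp: is_subring_def\<close>)

lemma is_subring_sum: "is_subring B \<Longrightarrow> (\<And>i. i \<in> I \<Longrightarrow> f i \<in> B) \<Longrightarrow> sum f I \<in> B"
  by (induction I rule: infinite_finite_induct) (auto simp: is_subringD)

lemma is_subring_prod: "is_subring B \<Longrightarrow> (\<And>i. i \<in> I \<Longrightarrow> f i \<in> B) \<Longrightarrow> prod f I \<in> B"
  by (induction I rule: infinite_finite_induct) (auto simp: is_subringD)

section \<open>Evaluation of multivariate polynomials\<close>

lemma mpoly_eq_sum_singles:
  fixes p :: "'b \<Rightarrow>\<^sub>0 'a::comm_monoid_add"
  shows "p = (\<Sum>m\<in>Poly_Mapping.keys p. Poly_Mapping.single m (Poly_Mapping.lookup p m))"
  by (rule poly_mapping_eqI) (auto simp: lookup_sum lookup_single when_def in_keys_iff)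

lemma meval_eq_sum_superset:
  assumes "h 0 = 0" "finite K" "Poly_Mapping.keys p \<subseteq> K"
  shows "meval h v p = (\<Sum>m\<in>K. h (Poly_Mapping.lookup p m) *
           (\<Prod>i\<in>Poly_Mapping.keys m. v i ^ Poly_Mapping.lookup m i))"
  unfolding meval_def
  by (rule sum.mono_neutral_left) (use assms in \<open>auto simp: in_keys_iff\<close>)

lemma meval_add:
  assumes "ring_hom h"
  shows "meval h v (p + q) = meval h v p + meval h v q"
proof -
  let ?K = "Poly_Mapping.keys p \<union> Poly_Mapping.keys q"
  have "Poly_Mapping.keys (p + q) \<subseteq> ?K"
    by (rule Poly_Mapping.keys_add)
  then show ?thesis
    using assms
    by (simp add: meval_eq_sum_superset[of h ?K] ring_homD lookup_add sum.distrib distrib_right)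
qed

lemma meval_single:
  "h 0 = 0 \<Longrightarrow> meval h v (Poly_Mapping.single m c) =
     h c * (\<Prod>i\<in>Poly_Mapping.keys m. v i ^ Poly_Mapping.lookup m i)"
  by (cases "c = 0") (auto simp: meval_def)

lemma meval_sum: "ring_hom h \<Longrightarrow> meval h v (sum f I) = (\<Sum>i\<in>I. meval h v (f i))"
  by (induction I rule: infinite_finite_induct) (auto simp: meval_add, auto simp: meval_def)

lemma monomial_eval_add:
  fixes v :: "nat \<Rightarrow> 'b::comm_semiring_1" and m m' :: "nat \<Rightarrow>\<^sub>0 nat"
  shows "(\<Prod>i\<in>Poly_Mapping.keys (m + m'). v i ^ Poly_Mapping.lookup (m + m') i) =
    (\<Prod>i\<in>Poly_Mapping.keys m. v i ^ Poly_Mapping.lookup m i) *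
    (\<Prod>i\<in>Poly_Mapping.keys m'. v i ^ Poly_Mapping.lookup m' i)"
proof -
  let ?K = "Poly_Mapping.keys m \<union> Poly_Mapping.keys m'"
  have *: "(\<Prod>i\<in>Poly_Mapping.keys a. v i ^ Poly_Mapping.lookup a i) =
      (\<Prod>i\<in>?K. v i ^ Poly_Mapping.lookup a i)"
    if "Poly_Mapping.keys a \<subseteq> ?K" for a :: "nat \<Rightarrow>\<^sub>0 nat"
    by (rule prod.mono_neutral_left) (use that in \<open>auto simp: in_keys_iff\<close>)
  show ?thesis
    unfolding *[OF Poly_Mapping.keys_add] *[of m, OF Un_upper1] *[of m', OF Un_upper2]
    by (simp add: lookup_add power_add prod.distrib)
qed

lemma meval_mult:
  assumes "ring_hom h"
  shows "meval h v (p * q) = meval h v p * meval h v q"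
proof -
  let ?s = "\<lambda>p m. Poly_Mapping.single m (Poly_Mapping.lookup p m)"
  have "p * q = (\<Sum>m\<in>Poly_Mapping.keys p. ?s p m) * (\<Sum>m\<in>Poly_Mapping.keys q. ?s q m)"
    using mpoly_eq_sum_singles[of p] mpoly_eq_sum_singles[of q] by simp
  also have "meval h v \<dots> = (\<Sum>m\<in>Poly_Mapping.keys p. \<Sum>m'\<in>Poly_Mapping.keys q.
      meval h v (?s p m) * meval h v (?s q m'))"
    unfolding sum_product
    by (simp add: meval_sum assms mult_single meval_single ring_homD monomial_eval_add mult_ac)
  also have "\<dots> = meval h v p * meval h v q"
    unfolding sum_product[symmetric] meval_sum[OF assms, symmetric]
    using mpoly_eq_sum_singles[of p] mpoly_eq_sum_singles[of q] by simp
  finally show ?thesis .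
qed

lemma meval_one: "ring_hom h \<Longrightarrow> meval h v 1 = 1"
  by (simp add: meval_def ring_homD)

lemma ring_hom_meval: "ring_hom h \<Longrightarrow> ring_hom (meval h v)"
  by (simp add: ring_hom_def[of "meval h v"] meval_add meval_mult meval_one)

lemma meval_Var: "ring_hom h \<Longrightarrow> meval h v (Var i) = v i"
  by (simp add: Var_def meval_single ring_homD)

lemma meval_Const: "ring_hom h \<Longrightarrow> meval h v (Const c) = h c"
  by (simp add: Const_def meval_single ring_homD)

lemma ring_hom_Const: "ring_hom Const"
  by (auto simp: ring_hom_def Const_def single_add mult_single)

lemma ring_hom_meval_comp:
  assumes "ring_hom \<phi>"
  shows "\<phi> (meval h v p) = meval (\<lambda>c. \<phi> (h c)) (\<lambda>i. \<phi> (v i)) p"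
  by (simp add: meval_def ring_hom_sum[OF assms] ring_hom_prod[OF assms] ring_homD[OF assms])

lemma meval_cong: "(\<And>i. i \<in> vars p \<Longrightarrow> v i = w i) \<Longrightarrow> meval h v p = meval h w p"
  unfolding meval_def vars_def
  by (intro sum.cong refl arg_cong2[of _ _ _ _ times] prod.cong arg_cong2[of _ _ _ _ power]) blast

lemma single_nat_eq_Var_power:
  "Poly_Mapping.single (Poly_Mapping.single i k) 1 = (Var i ^ k :: 'a::comm_ring_1 mpoly)"
proof (induction k)
  case (Suc k)
  have "(Var i ^ Suc k :: 'a mpoly) = Poly_Mapping.single (Poly_Mapping.single i 1 + Poly_Mapping.single i k) 1"
    unfolding power_Suc Suc[symmetric] by (simp add: Var_def mult_single)
  then show ?case
    by (simp add: single_add[symmetric])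
qed simp

lemma prod_Var_power:
  assumes "finite K"
  shows "(\<Prod>i\<in>K. Var i ^ f i :: 'a::comm_ring_1 mpoly) =
    Poly_Mapping.single (\<Sum>i\<in>K. Poly_Mapping.single i (f i)) 1"
  using assms by induction (auto simp: single_nat_eq_Var_power[symmetric] mult_single)

lemma meval_Const_Var: "meval Const Var p = (p :: 'a::comm_ring_1 mpoly)"
proof -
  have "meval Const Var p = (\<Sum>m\<in>Poly_Mapping.keys p. Poly_Mapping.single m (Poly_Mapping.lookup p m))"
    unfolding meval_def
    by (intro sum.cong refl)
       (simp add: prod_Var_power Const_def mult_single flip: mpoly_eq_sum_singles)
  then show ?thesis
    by (simp flip: mpoly_eq_sum_singles)
qed

lemma meval_in_subring:
  assumes "is_subring B" "\<And>c. h c \<in> B" "\<And>i. i \<in> vars p \<Longrightarrow> v i \<in> B"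
  shows "meval h v p \<in> B"
  unfolding meval_def using assms
  by (intro is_subring_sum is_subringD is_subring_prod) (auto simp: vars_def)

lemma finite_vars: "finite (vars p)"
  by (simp add: vars_def)

text \<open>R[x_i : i in \<open>W\<close>] is modelled as a subset of one fixed type, so that
  inductions on the number of variables become inductions on the finite set
  \<open>W\<close>.\<close>

definition mpolys :: "nat set \<Rightarrow> 'a::comm_ring_1 mpoly set" where
  "mpolys W = {p. vars p \<subseteq> W}"

lemma is_subring_mpolys: "is_subring (mpolys W)"
  unfolding is_subring_def
proof (intro conjI ballI)
  fix p q :: "'a mpoly" assume pq: "p \<in> mpolys W" "q \<in> mpolys W"
  have "Poly_Mapping.keys (p - q) \<subseteq> Poly_Mapping.keys p \<union> Poly_Mapping.keys q"
    by (auto simp: in_keys_iff lookup_minus)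
  then show "p - q \<in> mpolys W"
    using pq unfolding mpolys_def vars_def by blast
  have "Poly_Mapping.keys m \<subseteq> W" if "m \<in> Poly_Mapping.keys (p * q)" for m
  proof -
    obtain a b where "m = a + b" "a \<in> Poly_Mapping.keys p" "b \<in> Poly_Mapping.keys q"
      using keys_mult[of p q] \<open>m \<in> _\<close> by blast
    then show ?thesis
      using pq Poly_Mapping.keys_add[of a b] unfolding mpolys_def vars_def by blast
  qed
  then show "p * q \<in> mpolys W"
    unfolding mpolys_def vars_def by blast
qed (simp add: mpolys_def vars_def)

lemmas mpolys_closed = is_subringD[OF is_subring_mpolys]

lemma Const_in_mpolys: "Const c \<in> mpolys W"
  by (auto simp: mpolys_def vars_def Const_def split: if_splits)

lemma Var_in_mpolys: "i \<in> W \<Longrightarrow> Var i \<in> mpolys W"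
  by (auto simp: mpolys_def vars_def Var_def)

lemma mpolys_empty: "p \<in> mpolys {} \<Longrightarrow> p = Const (Poly_Mapping.lookup p 0)"
proof (rule poly_mapping_eqI)
  fix m assume "p \<in> mpolys {}"
  then have "Poly_Mapping.keys p \<subseteq> {0}"
    by (auto simp: mpolys_def vars_def)
  then show "Poly_Mapping.lookup p m = Poly_Mapping.lookup (Const (Poly_Mapping.lookup p 0)) m"
    by (auto simp: Const_def lookup_single when_def in_keys_iff)
qed

text \<open>The image of a polynomial under \<open>R[x] \<cong> R[x\<^sub>i : i \<noteq> v][x\<^sub>v]\<close>.\<close>

definition as_poly :: "nat \<Rightarrow> 'a::comm_ring_1 mpoly \<Rightarrow> 'a mpoly poly" where
  "as_poly v p = meval (\<lambda>c. [:Const c:]) (\<lambda>i. if i = v then [:0, 1:] else [:Var i:]) p"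

abbreviation cf :: "nat \<Rightarrow> 'a::comm_ring_1 mpoly \<Rightarrow> nat \<Rightarrow> 'a mpoly" where
  "cf v p i \<equiv> coeff (as_poly v p) i"

lemma ring_hom_pCons0: "ring_hom (\<lambda>c. [:c:])"
  by (auto simp: ring_hom_def one_pCons)

lemma ring_hom_const_Const: "ring_hom (\<lambda>c. [:Const c:])"
  using ring_hom_comp[OF ring_hom_pCons0 ring_hom_Const] by (simp add: comp_def)

lemma ring_hom_as_poly: "ring_hom (as_poly v)"
  unfolding as_poly_def by (rule ring_hom_meval[OF ring_hom_const_Const, unfolded eta_contract_eq])

lemmas as_poly_simps = ring_homD[OF ring_hom_as_poly]

lemma ring_hom_poly: "ring_hom (\<lambda>p. poly p a)"
  by (auto simp: ring_hom_def)

lemma poly_as_poly: "poly (as_poly v p) (Var v) = p"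
proof -
  have "poly (as_poly v p) (Var v) =
    meval (\<lambda>c. Const c) (\<lambda>i. poly (if i = v then [:0, 1:] else [:Var i:]) (Var v)) p"
    unfolding as_poly_def by (subst ring_hom_meval_comp[OF ring_hom_poly]) simp
  also have "(\<lambda>i. poly (if i = v then [:0, 1:] else [:Var i:]) (Var v :: 'a mpoly)) = Var"
    by auto
  finally show ?thesis
    by (simp add: meval_Const_Var)
qed

lemma as_poly_inject: "as_poly v p = as_poly v q \<longleftrightarrow> p = q"
  by (metis poly_as_poly)

lemma as_poly_eq_0_iff: "as_poly v p = 0 \<longleftrightarrow> p = 0"
  using as_poly_inject[of v p 0] by (simp add: as_poly_simps)

lemma as_poly_not_in_vars:
  assumes "v \<notin> vars p"
  shows "as_poly v p = [:p:]"
proof -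
  have "as_poly v p = meval (\<lambda>c. [:Const c:]) (\<lambda>i. [:Var i:]) p"
    unfolding as_poly_def by (rule meval_cong) (use assms in auto)
  also have "\<dots> = [:meval Const Var p:]"
    by (subst ring_hom_meval_comp[OF ring_hom_pCons0]) simp
  finally show ?thesis
    by (simp add: meval_Const_Var)
qed

lemma as_poly_Var: "as_poly v (Var v) = [:0, 1:]"
  by (simp add: as_poly_def meval_Var[OF ring_hom_const_Const])

lemma is_subring_coeffs:
  assumes "is_subring B"
  shows "is_subring {p. \<forall>i. coeff p i \<in> B}"
  unfolding is_subring_def
  by (auto simp: coeff_mult coeff_pCons one_pCons is_subringD[OF assms] split: nat.split
      intro!: is_subring_sum[OF assms])

lemma cf_in_mpolys:
  assumes "p \<in> mpolys W"
  shows "cf v p i \<in> mpolys (W - {v})"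
proof -
  have "as_poly v p \<in> {q. \<forall>i. coeff q i \<in> mpolys (W - {v})}"
    unfolding as_poly_def
    by (rule meval_in_subring[OF is_subring_coeffs[OF is_subring_mpolys]])
       (use assms in \<open>auto simp: coeff_pCons mpolys_closed Const_in_mpolys Var_in_mpolys mpolys_def[of W]
         split: nat.split\<close>)
  then show ?thesis by auto
qed

lemma mpoly_eq_sum_cf: "p = (\<Sum>i\<le>degree (as_poly v p). cf v p i * Var v ^ i)"
  using poly_as_poly[of v p] by (simp add: poly_altdef)

text \<open>If the degree in the variable is 0, \<open>p\<close> equals its constant coefficient,
  which is free of that variable. This turns questions about \<open>vars\<close> into questions
  about degrees, which add up over a domain.\<close>

lemma degree_as_poly_pos_iff: "degree (as_poly v p) > 0 \<longleftrightarrow> v \<in> vars p"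
proof
  assume *: "v \<in> vars p"
  show "degree (as_poly v p) > 0"
  proof (rule ccontr)
    assume "\<not> ?thesis"
    then have "p = cf v p 0"
      using mpoly_eq_sum_cf[of p v] by simp
    moreover have "cf v p 0 \<in> mpolys (UNIV - {v})"
      by (rule cf_in_mpolys) (auto simp: mpolys_def)
    ultimately show False
      using * by (auto simp: mpolys_def)
  qed
qed (use as_poly_not_in_vars in fastforce)

lemma vars_mult:
  fixes p q :: "'a::idom mpoly"
  assumes "p \<noteq> 0" "q \<noteq> 0"
  shows "vars (p * q) = vars p \<union> vars q"
proof -
  have "v \<in> vars (p * q) \<longleftrightarrow> v \<in> vars p \<or> v \<in> vars q" for v
    using assms
    by (simp add: degree_as_poly_pos_iff[symmetric] as_poly_simps degree_mult_eq as_poly_eq_0_iff)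
  then show ?thesis by auto
qed

lemma dvd_imp_vars_subset:
  fixes p q :: "'a::idom mpoly"
  assumes "p dvd q" "q \<noteq> 0"
  shows "vars p \<subseteq> vars q"
  using assms by (auto simp: vars_mult elim!: dvdE)

lemma dvd_in_mpolys:
  fixes p q :: "'a::idom mpoly"
  assumes "p dvd q" "q \<noteq> 0" "q \<in> mpolys W"
  shows "p \<in> mpolys W"
  using dvd_imp_vars_subset[OF assms(1,2)] assms(3) by (auto simp: mpolys_def)

lemma factors_in_mpolys:
  fixes p q :: "'a::idom mpoly"
  assumes "p * q \<in> mpolys W" "p * q \<noteq> 0"
  shows "p \<in> mpolys W" "q \<in> mpolys W"
  using assms dvd_in_mpolys[of _ "p * q" W] by auto

lemma dvd_iff_dvd_cf:
  fixes p q :: "'a::idom mpoly"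
  assumes "v \<notin> vars p"
  shows "p dvd q \<longleftrightarrow> (\<forall>i. p dvd cf v q i)"
proof
  assume "p dvd q"
  then show "\<forall>i. p dvd cf v q i"
    by (auto simp: as_poly_simps as_poly_not_in_vars[OF assms] elim!: dvdE)
next
  assume *: "\<forall>i. p dvd cf v q i"
  show "p dvd q"
    by (subst mpoly_eq_sum_cf[of q v]) (use * in \<open>auto intro!: dvd_sum dvd_mult2\<close>)
qed

lemma Var_dvd_iff: "Var v dvd p \<longleftrightarrow> cf v p 0 = 0"
proof
  assume "Var v dvd p"
  then show "cf v p 0 = 0"
    by (auto simp: as_poly_simps as_poly_Var elim!: dvdE)
next
  assume *: "cf v p 0 = 0"
  show "Var v dvd p"
  proof (subst mpoly_eq_sum_cf[of p v], rule dvd_sum)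
    fix i show "Var v dvd cf v p i * Var v ^ i"
      by (cases i) (auto simp: * intro!: dvd_mult)
  qed
qed

text \<open>Divisibility by the variable means that the coefficient of degree 0 vanishes, and these
  coefficients are multiplicative in a domain.\<close>

lemma prime_elem_Var: "prime_elem (Var v :: 'a::idom mpoly)"
  unfolding prime_elem_def
proof (intro conjI allI impI)
  have "as_poly v (Var v :: 'a mpoly) \<noteq> 0"
    by (simp add: as_poly_Var)
  then show "Var v \<noteq> (0 :: 'a mpoly)"
    by (metis as_poly_eq_0_iff)
  show "\<not> (Var v :: 'a mpoly) dvd 1"
    by (simp add: Var_dvd_iff as_poly_simps)
qed (auto simp: Var_dvd_iff as_poly_simps coeff_mult)

lemma meval_eq_sum_cf:
  assumes "ring_hom h"
  shows "meval h x p = (\<Sum>i\<le>degree (as_poly v p). meval h x (cf v p i) * x v ^ i)"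
  by (subst mpoly_eq_sum_cf[of p v])
     (simp add: meval_sum meval_mult assms meval_Var ring_homD[OF ring_hom_meval[OF assms]])

section \<open>Unique factorization of multivariate polynomials\<close>

text \<open>A substitute for the number of prime factors. Additivity makes the cofactor of a nonunit
  strictly smaller, so it serves as the measure in inductions over factorizations.\<close>

definition factor_size :: "nat set \<Rightarrow> ('a::idom mpoly \<Rightarrow> nat) \<Rightarrow> bool" where
  "factor_size W \<mu> \<longleftrightarrow>
    (\<forall>p\<in>mpolys W. \<forall>q\<in>mpolys W. p \<noteq> 0 \<longrightarrow> q \<noteq> 0 \<longrightarrow> \<mu> (p * q) = \<mu> p + \<mu> q) \<and>
    (\<forall>p\<in>mpolys W. p \<noteq> 0 \<longrightarrow> \<mu> p = 0 \<longrightarrow> p dvd 1)"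

lemma factor_sizeD:
  assumes "factor_size W \<mu>"
  shows "p \<in> mpolys W \<Longrightarrow> q \<in> mpolys W \<Longrightarrow> p \<noteq> 0 \<Longrightarrow> q \<noteq> 0 \<Longrightarrow> \<mu> (p * q) = \<mu> p + \<mu> q"
    and "p \<in> mpolys W \<Longrightarrow> p \<noteq> 0 \<Longrightarrow> \<mu> p = 0 \<Longrightarrow> p dvd 1"
  using assms by (auto simp: factor_size_def)

text \<open>Constants are measured by the number of their prime factors in R. For a new variable the
  degree is added to the size of the leading coefficient; the sum is additive because leading
  coefficients multiply over a domain.\<close>

lemma factor_size_exists:
  assumes "finite W"
  shows "\<exists>\<mu> :: 'a::{factorial_semiring, idom} mpoly \<Rightarrow> nat. factor_size W \<mu>"
  using assms
proof (induction W)
  case empty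
  define \<mu> where "\<mu> p = size (prime_factorization (Poly_Mapping.lookup p 0))" for p :: "'a mpoly"
  show ?case
    unfolding factor_size_def
  proof (rule exI[of _ \<mu>], intro conjI ballI impI)
    fix p q :: "'a mpoly" assume "p \<in> mpolys {}" "q \<in> mpolys {}" and nz: "p \<noteq> 0" "q \<noteq> 0"
    then obtain a b where ab: "p = Const a" "q = Const b"
      by (metis mpolys_empty)
    with nz have "a \<noteq> 0" "b \<noteq> 0"
      by (auto simp: Const_def)
    then show "\<mu> (p * q) = \<mu> p + \<mu> q"
      unfolding ab ring_homD(4)[OF ring_hom_Const, symmetric]
      by (simp add: \<mu>_def Const_def prime_factorization_mult)
  next
    fix p :: "'a mpoly" assume "p \<in> mpolys {}" and nz: "p \<noteq> 0" "\<mu> p = 0"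
    then obtain a where a: "p = Const a"
      by (metis mpolys_empty)
    with nz have "a dvd 1"
      by (auto simp: \<mu>_def Const_def prime_factorization_empty_iff)
    then show "p dvd 1"
      using ring_hom_dvd[OF ring_hom_Const, of a 1] by (simp add: a ring_homD[OF ring_hom_Const])
  qed
next
  case (insert v W)
  then obtain \<mu> :: "'a mpoly \<Rightarrow> nat" where \<mu>: "factor_size W \<mu>"
    by blast
  note add = factor_sizeD(1)[OF \<mu>] and unit = factor_sizeD(2)[OF \<mu>]
  define \<nu> where "\<nu> p = degree (as_poly v p) + \<mu> (lead_coeff (as_poly v p))" for p
  have lc: "lead_coeff (as_poly v p) \<in> mpolys W" if "p \<in> mpolys (insert v W)" for p :: "'a mpoly"
    using cf_in_mpolys[OF that, of v] insert.hyps by simp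
  show ?case
    unfolding factor_size_def
  proof (rule exI[of _ \<nu>], intro conjI ballI impI)
    fix p q :: "'a mpoly"
    assume pq: "p \<in> mpolys (insert v W)" "q \<in> mpolys (insert v W)" "p \<noteq> 0" "q \<noteq> 0"
    have "\<mu> (lead_coeff (as_poly v (p * q))) =
        \<mu> (lead_coeff (as_poly v p) * lead_coeff (as_poly v q))"
      by (simp only: as_poly_simps lead_coeff_mult)
    also have "\<dots> = \<mu> (lead_coeff (as_poly v p)) + \<mu> (lead_coeff (as_poly v q))"
      by (rule add) (use pq in \<open>simp_all add: lc as_poly_eq_0_iff\<close>)
    finally show "\<nu> (p * q) = \<nu> p + \<nu> q"
      using pq unfolding \<nu>_def as_poly_simps by (simp add: degree_mult_eq as_poly_eq_0_iff)
  next
    fix p :: "'a mpoly" assume p: "p \<in> mpolys (insert v W)" "p \<noteq> 0" "\<nu> p = 0"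
    have "lead_coeff (as_poly v p) \<noteq> 0"
      using p(2) by (simp add: as_poly_eq_0_iff)
    moreover have "degree (as_poly v p) = 0" "\<mu> (lead_coeff (as_poly v p)) = 0"
      using p(3) unfolding \<nu>_def add_is_0 by blast+
    ultimately have "lead_coeff (as_poly v p) dvd 1" "degree (as_poly v p) = 0"
      using unit[OF lc[OF p(1)]] by blast+
    then show "p dvd 1"
      using poly_as_poly[of v p] by (simp add: poly_altdef)
  qed
qed

lemma irreducible_factor_exists:
  fixes p :: "'a::{factorial_semiring, idom} mpoly"
  assumes "p \<noteq> 0" "\<not> p dvd 1"
  obtains q p' where "irreducible q" "p = q * p'"
proof -
  obtain \<mu> :: "'a mpoly \<Rightarrow> nat" where \<mu>: "factor_size (vars p) \<mu>"
    using factor_size_exists[OF finite_vars] by blast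
  note add = factor_sizeD(1)[OF \<mu>] and unit = factor_sizeD(2)[OF \<mu>]
  have "\<exists>q. irreducible q \<and> q dvd a" if "a \<in> mpolys (vars p)" "a \<noteq> 0" "\<not> a dvd 1" for a :: "'a mpoly"
    using that
  proof (induction "\<mu> a" arbitrary: a rule: less_induct)
    case less
    show ?case
    proof (cases "irreducible a")
      case False
      then obtain b c where bc: "a = b * c" "\<not> b dvd 1" "\<not> c dvd 1"
        using less.prems by (auto simp: irreducible_def)
      with less.prems have in_W: "b \<in> mpolys (vars p)" "c \<in> mpolys (vars p)"
        using factors_in_mpolys by metis+
      have nz: "b \<noteq> 0" "c \<noteq> 0"
        using bc less.prems by auto
      then have "\<mu> b < \<mu> a"
        using add[of b c] unit[of c] in_W bc by fastforce
      from less.hyps[OF this in_W(1) nz(1) bc(2)] show ?thesis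
        using bc(1) by (auto intro: dvd_mult2)
    qed auto
  qed
  from this[of p] obtain q where "irreducible q" "q dvd p"
    using assms by (auto simp: mpolys_def)
  then show ?thesis
    using that by (auto elim!: dvdE)
qed

text \<open>Existence of a factorization into irreducibles, packaged as an induction: each factor
  split off is a nonunit and lowers the factor size.\<close>

lemma mpoly_factor_induct [consumes 1, case_names unit factor]:
  fixes p :: "'a::{factorial_semiring, idom} mpoly"
  assumes "p \<noteq> 0"
    and unit: "\<And>u. u dvd 1 \<Longrightarrow> P u"
    and factor: "\<And>q p. irreducible q \<Longrightarrow> p \<noteq> 0 \<Longrightarrow> P p \<Longrightarrow> P (q * p)"
  shows "P p"
proof -
  obtain \<mu> :: "'a mpoly \<Rightarrow> nat" where \<mu>: "factor_size (vars p) \<mu>"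
    using factor_size_exists[OF finite_vars] by blast
  note add = factor_sizeD(1)[OF \<mu>] and unit' = factor_sizeD(2)[OF \<mu>]
  have "P a" if "a \<in> mpolys (vars p)" "a \<noteq> 0" for a :: "'a mpoly"
    using that
  proof (induction "\<mu> a" arbitrary: a rule: less_induct)
    case less
    show ?case
    proof (cases "a dvd 1")
      case False
      then obtain q b where qb: "irreducible q" "a = q * b"
        using irreducible_factor_exists[OF less.prems(2)] by metis
      have nz: "q \<noteq> 0" "b \<noteq> 0"
        using qb less.prems by auto
      have in_W: "q \<in> mpolys (vars p)" "b \<in> mpolys (vars p)"
        using factors_in_mpolys[of q b] qb less.prems by auto
      have "\<not> q dvd 1"
        using qb by (auto simp: irreducible_def)
      then have "\<mu> b < \<mu> a"
        using add[of q b] unit'[of q] in_W nz qb(2) by fastforce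
      then show ?thesis
        using less.hyps[of b] factor qb nz in_W by blast
    qed (use unit in auto)
  qed
  from this[of p] assms(1) show ?thesis
    by (auto simp: mpolys_def)
qed

section \<open>Gauss's theorem: irreducible polynomials are prime\<close>

lemma prime_in_mpolys_insert:
  fixes q :: "'a::idom mpoly"
  assumes q: "q \<in> mpolys W" and "v \<notin> W"
    and prime: "\<And>g h. g \<in> mpolys W \<Longrightarrow> h \<in> mpolys W \<Longrightarrow> q dvd g * h \<Longrightarrow> q dvd g \<or> q dvd h"
    and GH: "G \<in> mpolys (insert v W)" "H \<in> mpolys (insert v W)" "q dvd G * H"
  shows "q dvd G \<or> q dvd H"
proof (rule ccontr)
  assume neg: "\<not> ?thesis"
  have v: "v \<notin> vars q"
    using q \<open>v \<notin> W\<close> by (auto simp: mpolys_def)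
  from neg have "\<exists>i. \<not> q dvd cf v G i" "\<exists>j. \<not> q dvd cf v H j"
    using dvd_iff_dvd_cf[OF v] by blast+
  \<comment> \<open>Gauss's argument: take the first coefficient of each factor that
    \<open>q\<close> does not divide and look at the coefficient of degree \<open>i + j\<close> of
    the product.\<close>
  then obtain i j where i: "\<not> q dvd cf v G i" "\<And>l. l < i \<Longrightarrow> q dvd cf v G l"
    and j: "\<not> q dvd cf v H j" "\<And>l. l < j \<Longrightarrow> q dvd cf v H l"
    by (subst (asm) (1 2) exists_least_iff) blast
  have "q dvd cf v (G * H) (i + j)"
    using GH dvd_iff_dvd_cf[OF v] by blast
  also have "cf v (G * H) (i + j) = (\<Sum>l\<le>i + j. cf v G l * cf v H (i + j - l))"
    by (simp add: as_poly_simps coeff_mult)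
  also have "\<dots> = cf v G i * cf v H j + (\<Sum>l\<in>{..i + j} - {i}. cf v G l * cf v H (i + j - l))"
    by (subst sum.remove[of _ i]) auto
  finally have "q dvd cf v G i * cf v H j + (\<Sum>l\<in>{..i + j} - {i}. cf v G l * cf v H (i + j - l))" .
  \<comment> \<open>Any other split of \<open>i + j\<close> has one index below \<open>i\<close> or
    below \<open>j\<close>, where minimality gives divisibility.\<close>
  moreover have "q dvd (\<Sum>l\<in>{..i + j} - {i}. cf v G l * cf v H (i + j - l))"
  proof (rule dvd_sum)
    fix l assume "l \<in> {..i + j} - {i}"
    then have "l < i \<or> i + j - l < j" by auto
    then show "q dvd cf v G l * cf v H (i + j - l)"
      using i(2) j(2) by (auto intro: dvd_mult dvd_mult2)
  qed
  ultimately have "q dvd cf v G i * cf v H j"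
    by (simp add: dvd_add_left_iff)
  then show False
    using prime[of "cf v G i" "cf v H j"] i(1) j(1) cf_in_mpolys[OF GH(1), of v i]
      cf_in_mpolys[OF GH(2), of v j] \<open>v \<notin> W\<close>
    by simp
qed

text \<open>Leading coefficients need not be invertible, so division with remainder in the variable
  \<open>v\<close> is carried out after multiplying by a nonzero \<open>c\<close> free of
  \<open>v\<close>.\<close>

lemma pseudo_division:
  fixes p r :: "'a::idom mpoly"
  assumes "v \<notin> W" "p \<in> mpolys (insert v W)" "r \<in> mpolys (insert v W)" "r \<noteq> 0"
  shows "\<exists>c q. c \<in> mpolys W \<and> c \<noteq> 0 \<and> q \<in> mpolys (insert v W) \<and>
    (c * p - q * r = 0 \<or> degree (as_poly v (c * p - q * r)) < degree (as_poly v r))"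
  using assms(2)
proof (induction "degree (as_poly v p)" arbitrary: p rule: less_induct)
  case less
  show ?case
  proof (cases "p = 0 \<or> degree (as_poly v p) < degree (as_poly v r)")
    case True
    then show ?thesis
      by (intro exI[of _ 1] exI[of _ 0]) (auto simp: mpolys_closed)
  next
    case False
    define d where "d = degree (as_poly v p) - degree (as_poly v r)"
    define a where "a = lead_coeff (as_poly v r)"
    define b where "b = lead_coeff (as_poly v p)"
    \<comment> \<open>Cross-multiplication by the leading coefficients cancels the terms of top
      degree.\<close>
    define p1 where "p1 = a * p - b * Var v ^ d * r"
    have ab: "a \<in> mpolys W" "b \<in> mpolys W" "a \<noteq> 0"
      using cf_in_mpolys[OF less.prems, of v] cf_in_mpolys[OF assms(3), of v] assms
      by (auto simp: a_def b_def as_poly_eq_0_iff)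
    have v: "v \<notin> vars a" "v \<notin> vars b"
      using ab \<open>v \<notin> W\<close> by (auto simp: mpolys_def)
    have sub: "mpolys W \<subseteq> (mpolys (insert v W) :: 'a mpoly set)"
      by (auto simp: mpolys_def)
    have q_in: "b * Var v ^ d \<in> mpolys (insert v W)" and p1_in: "p1 \<in> mpolys (insert v W)"
      unfolding p1_def using sub ab less.prems assms(3)
      by (auto intro!: mpolys_closed Var_in_mpolys)
    have deg: "degree (as_poly v p) = d + degree (as_poly v r)"
      using False by (auto simp: d_def)
    have eq: "as_poly v p1 = smult a (as_poly v p) - monom b d * as_poly v r"
      using v by (simp add: p1_def as_poly_simps as_poly_not_in_vars as_poly_Var monom_altdef)
    have "degree (as_poly v p1) \<le> degree (as_poly v p)"
      unfolding eq using degree_mult_le[of "monom b d" "as_poly v r"] degree_monom_le[of b d]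
      by (intro degree_diff_le) (auto simp: deg)
    moreover have "cf v p1 (degree (as_poly v p)) = 0"
      unfolding eq by (simp add: coeff_monom_mult deg a_def b_def)
    ultimately have "p1 = 0 \<or> degree (as_poly v p1) < degree (as_poly v p)"
      by (metis as_poly_eq_0_iff leading_coeff_0_iff le_neq_implies_less)
    then show ?thesis
    proof
      assume "p1 = 0"
      then show ?thesis
        using ab q_in by (intro exI[of _ a] exI[of _ "b * Var v ^ d"]) (auto simp: p1_def)
    next
      assume "degree (as_poly v p1) < degree (as_poly v p)"
      from less.hyps[OF this p1_in] obtain c q where cq: "c \<in> mpolys W" "c \<noteq> 0"
        "q \<in> mpolys (insert v W)"
        "c * p1 - q * r = 0 \<or> degree (as_poly v (c * p1 - q * r)) < degree (as_poly v r)"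
        by blast
      have "c * a * p - (c * (b * Var v ^ d) + q) * r = c * p1 - q * r"
        by (simp add: p1_def algebra_simps)
      then show ?thesis
        using cq ab q_in sub
        by (intro exI[of _ "c * a"] exI[of _ "c * (b * Var v ^ d) + q"])
           (auto simp: mpolys_closed subset_iff)
    qed
  qed
qed

text \<open>With \<open>W\<close> the variables other than the main one, this is the condition that
  the content is a unit.\<close>

definition primitive_over :: "nat set \<Rightarrow> 'a::comm_ring_1 mpoly \<Rightarrow> bool" where
  "primitive_over W p \<longleftrightarrow> (\<forall>a\<in>mpolys W. a dvd p \<longrightarrow> a dvd 1)"

text \<open>Factors from R[\<open>W\<close>] are split off as long as a nonunit one is left; the
  factor size drops each time.\<close>

lemma content_exists:
  fixes r :: "'a::{factorial_semiring, idom} mpoly"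
  assumes "r \<noteq> 0"
  shows "\<exists>a s. a \<in> mpolys W \<and> primitive_over W s \<and> r = a * s"
proof -
  obtain \<mu> :: "'a mpoly \<Rightarrow> nat" where \<mu>: "factor_size (vars r) \<mu>"
    using factor_size_exists[OF finite_vars] by blast
  note add = factor_sizeD(1)[OF \<mu>] and unit = factor_sizeD(2)[OF \<mu>]
  have "\<exists>a s. a \<in> mpolys W \<and> primitive_over W s \<and> p = a * s" if "p \<in> mpolys (vars r)" "p \<noteq> 0" for p :: "'a mpoly"
    using that
  proof (induction "\<mu> p" arbitrary: p rule: less_induct)
    case less
    show ?case
    proof (cases "primitive_over W p")
      case True
      then show ?thesis
        by (intro exI[of _ 1] exI[of _ p]) (auto simp: mpolys_closed)
    next
      case False
      then obtain a b where ab: "a \<in> mpolys W" "\<not> a dvd 1" "p = a * b"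
        unfolding primitive_over_def dvd_def by blast
      have nz: "a \<noteq> 0" "b \<noteq> 0"
        using ab less.prems by auto
      have in_W: "a \<in> mpolys (vars r)" "b \<in> mpolys (vars r)"
        using factors_in_mpolys[of a b] ab less.prems by auto
      have "\<mu> b < \<mu> p"
        using add[of a b] unit[of a] in_W nz ab by fastforce
      from less.hyps[OF this in_W(2) nz(2)] obtain a' s where
        "a' \<in> mpolys W" "primitive_over W s" "b = a' * s" by blast
      then show ?thesis
        using ab by (intro exI[of _ "a * a'"] exI[of _ s]) (auto simp: mpolys_closed mult.assoc)
    qed
  qed
  from this[of r] assms show ?thesis
    by (auto simp: mpolys_def)
qed

text \<open>The prime factors of \<open>c\<close> are cancelled one at a time: each divides
  \<open>r * s\<close> but not the primitive \<open>r\<close>, hence divides the cofactor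
  \<open>s\<close>. Primality is a hypothesis because the lemma is applied inside the induction on
  variables that establishes it.\<close>

lemma primitive_dvd_cancel:
  fixes r :: "'a::{factorial_semiring, idom} mpoly"
  assumes prime: "\<And>q g h :: 'a mpoly. q \<in> mpolys W \<Longrightarrow> irreducible q \<Longrightarrow> g \<in> mpolys W' \<Longrightarrow> h \<in> mpolys W' \<Longrightarrow>
      q dvd g * h \<Longrightarrow> q dvd g \<or> q dvd h"
    and "W \<subseteq> W'" and r: "r \<in> mpolys W'" "primitive_over W r"
    and "c \<in> mpolys W" "c \<noteq> 0" "f \<in> mpolys W'" "r dvd c * f"
  shows "r dvd f"
proof -
  from \<open>c \<noteq> 0\<close> have "\<forall>f\<in>mpolys W'. c \<in> mpolys W \<longrightarrow> r dvd c * f \<longrightarrow> r dvd f"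
  proof (induction rule: mpoly_factor_induct)
    case (unit u)
    then have "u * f dvd f" for f
      using mult_dvd_mono[of u 1 f f] by simp
    then show ?case
      using dvd_trans by blast
  next
    case (factor q c)
    show ?case
    proof (intro ballI impI)
      fix f assume f: "f \<in> mpolys W'" "q * c \<in> mpolys W" "r dvd q * c * f"
      have q0: "q \<noteq> 0" "\<not> q dvd 1"
        using factor by (auto simp: irreducible_def)
      have W: "q \<in> mpolys W" "c \<in> mpolys W"
        using f(2) factor q0 by (auto intro: dvd_in_mpolys[of _ "q * c"])
      show "r dvd f"
      proof (cases "f = 0")
        case False
        from f(3) obtain s where s: "q * c * f = r * s" by (auto elim: dvdE)
        have "q * c * f \<in> mpolys W'"
          using f \<open>W \<subseteq> W'\<close> by (intro mpolys_closed(6)[of "q * c"]) (auto simp: mpolys_def)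
        then have "s \<in> mpolys W'"
          using s q0 factor False by (auto intro!: dvd_in_mpolys[of s "q * c * f"])
        moreover have "q dvd r * s"
          using s by (metis dvd_triv_left mult.assoc)
        ultimately have "q dvd s"
          using prime[OF W(1) factor(1) r(1)] r(2) q0 W by (auto simp: primitive_over_def)
        then obtain t where "s = q * t" by (auto elim: dvdE)
        with s q0 have "c * f = r * t"
          by (simp add: mult.left_commute mult.assoc)
        then show ?thesis
          using factor.IH f W by auto
      qed auto
    qed
  qed
  then show ?thesis
    using assms by blast
qed

text \<open>Induction on the variables. If \<open>f\<close> involves the new variable, it is
  primitive over the others. A combination of \<open>f\<close> and \<open>g\<close> of least degree
  has a primitive part \<open>s\<close> dividing both. As \<open>f\<close> is irreducible, either
  \<open>s\<close> is an associate of \<open>f\<close>, which gives \<open>f dvd g\<close>, or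
  \<open>s\<close> is a unit, and then a Bezout relation gives \<open>f dvd h\<close>.\<close>

lemma irreducible_dvd_mult_in_mpolys:
  fixes f g h :: "'a::{factorial_semiring, idom} mpoly"
  assumes "finite W" "f \<in> mpolys W" "g \<in> mpolys W" "h \<in> mpolys W" "irreducible f" "f dvd g * h"
  shows "f dvd g \<or> f dvd h"
  using assms
proof (induction W arbitrary: f g h)
  case empty
  then obtain a b c where abc: "f = Const a" "g = Const b" "h = Const c"
    by (metis mpolys_empty)
  have Const_dvd: "Const u dvd (Const w :: 'a mpoly) \<longleftrightarrow> u dvd w" for u w
  proof
    assume "Const u dvd (Const w :: 'a mpoly)"
    then obtain p where "Const w = Const u * p" by (auto elim: dvdE)
    then have "Poly_Mapping.lookup (Const w) 0 = Poly_Mapping.lookup (Const u * p) 0" by simp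
    then show "u dvd w"
      by (simp add: Const_def mult_map_scale_conv_mult[symmetric] map.rep_eq when_def)
  qed (rule ring_hom_dvd[OF ring_hom_Const])
  have one: "Const 1 = (1 :: 'a mpoly)" and mult: "Const (u * w) = Const u * (Const w :: 'a mpoly)" for u w
    by (rule ring_homD[OF ring_hom_Const])+
  have "irreducible a"
  proof (rule irreducibleI)
    show "a \<noteq> 0" "\<not> a dvd 1"
      using empty.prems Const_dvd[of a 1] unfolding abc by (auto simp: irreducible_def one Const_def)
    show "u dvd 1 \<or> w dvd 1" if "a = u * w" for u w
      using irreducibleD[OF empty.prems(4), of "Const u" "Const w"] that Const_dvd[of _ 1]
      by (simp add: abc one mult)
  qed
  then have "prime_elem a" by (rule irreducible_imp_prime_elem)
  moreover have "a dvd b * c"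
    using empty.prems unfolding abc mult[symmetric] Const_dvd by simp
  ultimately show ?case
    unfolding abc Const_dvd by (rule prime_elem_dvd_multD)
next
  case (insert v W)
  let ?W' = "insert v W"
  have sub: "mpolys W \<subseteq> (mpolys ?W' :: 'a mpoly set)"
    by (auto simp: mpolys_def)
  \<comment> \<open>For irreducibles free of the new variable, primality extends from the induction
    hypothesis to the larger ring.\<close>
  have lift: "q dvd G \<or> q dvd H" if "q \<in> mpolys W" "irreducible q" "G \<in> mpolys ?W'" "H \<in> mpolys ?W'"
    "q dvd G * H" for q G H :: "'a mpoly"
    by (rule prime_in_mpolys_insert[OF that(1) insert.hyps(2) insert.IH[OF that(1) _ _ that(2)] that(3-5)])
  note cancel = primitive_dvd_cancel[OF lift, of W ?W', OF _ _ _ _ _ subset_insertI]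
  have f0: "f \<noteq> 0" using insert.prems by (auto simp: irreducible_def)
  show ?case
  proof (cases "v \<in> vars f")
    case False
    then have "f \<in> mpolys W"
      using insert.prems by (auto simp: mpolys_def)
    then show ?thesis
      using lift insert.prems by blast
  next
    case True
    have f_prim: "primitive_over W f"
      unfolding primitive_over_def
    proof (intro ballI impI)
      fix a assume a: "a \<in> mpolys W" "a dvd f"
      then obtain s where s: "f = a * s" by (auto elim: dvdE)
      \<comment> \<open>If the cofactor \<open>s\<close> were a unit, \<open>f\<close> would be an
        associate of \<open>a\<close> and hence free of \<open>v\<close>.\<close>
      have "\<not> s dvd 1"
      proof
        assume "s dvd 1"
        then have "f dvd a"
          using mult_dvd_mono[of a a s 1] by (simp add: s)
        then have "f \<in> mpolys W"
          using dvd_in_mpolys[of f a W] a s f0 by auto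
        then show False
          using True insert.hyps by (auto simp: mpolys_def)
      qed
      then show "a dvd 1"
        using irreducibleD[OF insert.prems(4) s] by blast
    qed
    \<comment> \<open>Nonzero elements of the ideal generated by \<open>f\<close> and
      \<open>g\<close>. The cofactors range over the whole type; only the combination itself is
      confined to the variables at hand.\<close>
    define I where "I r \<longleftrightarrow> r \<noteq> 0 \<and> r \<in> mpolys ?W' \<and> (\<exists>u w. r = u * f + w * g)" for r
    have "I f"
      using f0 insert.prems by (auto simp: I_def intro: exI[of _ 1] exI[of _ 0])
    then obtain r where r: "I r" and min: "\<And>r'. I r' \<Longrightarrow> degree (as_poly v r) \<le> degree (as_poly v r')"
      using ex_has_least_nat[of I f "\<lambda>r. degree (as_poly v r)"] by blast
    from r obtain u w where r0: "r \<noteq> 0" "r \<in> mpolys ?W'" and uw: "r = u * f + w * g"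
      by (auto simp: I_def)
    \<comment> \<open>The pseudo-remainder is again such a combination, of smaller degree than
      \<open>r\<close>, so minimality forces it to be 0.\<close>
    have rem0: "\<exists>c. c \<in> mpolys W \<and> c \<noteq> 0 \<and> r dvd c * p"
      if p: "p \<in> mpolys ?W'" "\<exists>u w. p = u * f + w * g" for p
    proof -
      obtain c q where cq: "c \<in> mpolys W" "c \<noteq> 0" "q \<in> mpolys ?W'"
        "c * p - q * r = 0 \<or> degree (as_poly v (c * p - q * r)) < degree (as_poly v r)"
        using pseudo_division[OF insert.hyps(2) p(1) r0(2,1)] by blast
      obtain u' w' where p': "p = u' * f + w' * g" using p by blast
      have "c * p - q * r = (c * u' - q * u) * f + (c * w' - q * w) * g"
        unfolding p' uw by (simp add: algebra_simps)
      moreover have "c * p - q * r \<in> mpolys ?W'"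
        using cq p r0 sub by (auto intro!: mpolys_closed)
      ultimately have "I (c * p - q * r)" if "c * p - q * r \<noteq> 0"
        using that unfolding I_def by blast
      then have "c * p = q * r"
        using min[of "c * p - q * r"] cq(4) by fastforce
      then show ?thesis
        using cq by auto
    qed
    \<comment> \<open>The primitive part \<open>s\<close> of \<open>r\<close> is a greatest common divisor of \<open>f\<close> and \<open>g\<close> over the fraction field of \<open>R[W]\<close>.\<close>
    obtain a s where as: "a \<in> mpolys W" "primitive_over W s" "r = a * s"
      using content_exists[OF r0(1)] by blast
    have s: "s \<in> mpolys ?W'" and "a \<noteq> 0"
      using factors_in_mpolys[of a s] r0 as by auto
    have s_dvd: "s dvd p" if p: "p \<in> mpolys ?W'" "\<exists>u w. p = u * f + w * g" for p
    proof -
      obtain c where "c \<in> mpolys W" "c \<noteq> 0" "r dvd c * p"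
        using rem0[OF p] by blast
      then show ?thesis
        using cancel[OF _ _ _ _ _ s as(2) _ _ p(1), of c] as(3) by (auto intro: dvd_mult_right)
    qed
    have "s dvd f" "s dvd g"
      by (rule s_dvd; use insert.prems in \<open>auto intro: exI[of _ 1] exI[of _ 0]\<close>)
        (rule s_dvd; use insert.prems in \<open>auto intro: exI[of _ 1] exI[of _ 0]\<close>)
    from \<open>s dvd f\<close> obtain t where t: "f = s * t" by (auto elim: dvdE)
    from irreducibleD[OF insert.prems(4) t] show ?thesis
    proof
      assume "t dvd 1"
      then have "f dvd s"
        using mult_dvd_mono[of s s t 1] by (simp add: t)
      then show ?thesis
        using \<open>s dvd g\<close> dvd_trans by blast
    next
      assume "s dvd 1"
      \<comment> \<open>Both summands are divisible by \<open>f\<close>. As \<open>s\<close> is a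
        unit, \<open>r\<close> divides \<open>a\<close>, which is free of \<open>v\<close> and
        therefore cancels against the primitive \<open>f\<close>.\<close>
      have "r * h = u * h * f + w * (g * h)"
        unfolding uw by (simp add: algebra_simps)
      then have "f dvd r * h"
        using insert.prems by simp
      moreover have "r * h dvd a * h"
        using mult_dvd_mono[OF mult_dvd_mono[of a a s 1], of h h] \<open>s dvd 1\<close> by (simp add: as)
      ultimately have "f dvd a * h"
        using dvd_trans by blast
      then show ?thesis
        using cancel[OF _ _ _ _ _ insert.prems(1) f_prim as(1) \<open>a \<noteq> 0\<close> insert.prems(3)] by blast
    qed
  qed
qed

lemma irreducible_imp_prime_elem_mpoly:
  fixes f :: "'a::{factorial_semiring, idom} mpoly"
  assumes "irreducible f"
  shows "prime_elem f"
proof (rule prime_elemI)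
  show "f \<noteq> 0" "\<not> f dvd 1"
    using assms by (auto simp: irreducible_def)
  fix g h assume "f dvd g * h"
  then show "f dvd g \<or> f dvd h"
    using assms irreducible_dvd_mult_in_mpolys[of "vars f \<union> vars g \<union> vars h" f g h]
    by (auto simp: finite_vars mpolys_def)
qed

text \<open>Irreducible factors of \<open>c\<close> are prime and do not divide \<open>Q\<close>, so
  each divides the cofactor of \<open>Q ^ m\<close> and can be cancelled. Coprimality is phrased
  through irreducible factors because a mutation supplies it in this form.\<close>

lemma power_dvd_mult_cancel:
  fixes Q c z :: "'a::{factorial_semiring, idom} mpoly"
  assumes "c \<noteq> 0" "\<And>q. irreducible q \<Longrightarrow> q dvd c \<Longrightarrow> \<not> q dvd Q" "Q ^ m dvd c * z"
  shows "Q ^ m dvd z"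
proof -
  from \<open>c \<noteq> 0\<close> have "(\<forall>q. irreducible q \<longrightarrow> q dvd c \<longrightarrow> \<not> q dvd Q) \<longrightarrow> (\<forall>z. Q ^ m dvd c * z \<longrightarrow> Q ^ m dvd z)"
  proof (induction rule: mpoly_factor_induct)
    case (unit u)
    then have "u * z dvd z" for z
      using mult_dvd_mono[of u 1 z z] by simp
    then show ?case
      using dvd_trans by blast
  next
    case (factor q c)
    show ?case
    proof (intro impI allI)
      fix z assume *: "\<forall>q'. irreducible q' \<longrightarrow> q' dvd q * c \<longrightarrow> \<not> q' dvd Q" "Q ^ m dvd q * c * z"
      from *(2) obtain s where s: "q * c * z = Q ^ m * s" by (rule dvdE)
      have "prime_elem q" "q \<noteq> 0"
        using factor by (auto simp: irreducible_imp_prime_elem_mpoly irreducible_def)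
      moreover have "q dvd Q ^ m * s"
        using s by (metis dvd_triv_left mult.assoc)
      moreover have "\<not> q dvd Q"
        using * factor(1) by auto
      ultimately have "q dvd s"
        using prime_elem_dvd_power prime_elem_dvd_multD by blast
      then obtain t where "s = q * t" by (auto elim: dvdE)
      with s \<open>q \<noteq> 0\<close> have "c * z = Q ^ m * t"
        by (simp add: mult.left_commute mult.assoc)
      then have "Q ^ m dvd c * z" by simp
      moreover have "\<forall>q'. irreducible q' \<longrightarrow> q' dvd c \<longrightarrow> \<not> q' dvd Q"
        using * by (auto intro: dvd_mult)
      ultimately show "Q ^ m dvd z"
        using factor.IH by blast
    qed
  qed
  then show ?thesis
    using assms by blast
qed

text \<open>Ensures that the \<open>GREATEST\<close> in \<open>hat_exp\<close> is attained. If
  \<open>q\<close> divides \<open>p\<close>, the factor size of \<open>q ^ m\<close> is at least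
  \<open>m\<close>, and at most that of \<open>p\<close> when \<open>q ^ m\<close> divides
  \<open>p\<close>.\<close>

lemma power_dvd_bounded:
  fixes q p :: "'a::{factorial_semiring, idom} mpoly"
  assumes "p \<noteq> 0" "\<not> q dvd 1"
  shows "\<exists>B. \<forall>m. q ^ m dvd p \<longrightarrow> m \<le> B"
proof (cases "q dvd p")
  case True
  obtain \<mu> :: "'a mpoly \<Rightarrow> nat" where \<mu>: "factor_size (vars p) \<mu>"
    using factor_size_exists[OF finite_vars] by blast
  note add = factor_sizeD(1)[OF \<mu>] and unit = factor_sizeD(2)[OF \<mu>]
  have p: "p \<in> mpolys (vars p)"
    by (simp add: mpolys_def)
  have q: "q \<in> mpolys (vars p)" "q \<noteq> 0"
    using dvd_in_mpolys[OF True assms(1) p] True assms by auto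
  have "m \<le> \<mu> (q ^ m)" for m
  proof (induction m)
    case (Suc m)
    have "\<mu> (q ^ Suc m) = \<mu> q + \<mu> (q ^ m)"
      using q by (auto intro!: add mpolys_closed)
    then show ?case
      using Suc unit[OF q] assms by fastforce
  qed simp
  moreover have "\<mu> (q ^ m) \<le> \<mu> p" if "q ^ m dvd p" for m
  proof -
    from that obtain s where s: "p = q ^ m * s" by (auto elim: dvdE)
    then have "s \<in> mpolys (vars p)" "s \<noteq> 0"
      using dvd_in_mpolys[of s p] p assms by auto
    with s q show ?thesis
      using add[of "q ^ m" s] by (auto simp: mpolys_closed)
  qed
  ultimately show ?thesis
    using order_trans by blast
next
  case False
  have "m = 0" if "q ^ m dvd p" for m
    using that False by (cases m) (auto dest: dvd_mult_left)
  then show ?thesis by blast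
qed

section \<open>Laurent rings and their exchanges\<close>

lemma ring_emb_imp_ring_hom: "ring_emb emb \<Longrightarrow> ring_hom emb"
  by (auto simp: ring_emb_def ring_hom_def)

lemma polyring_eq_image: "polyring emb S x = meval emb x ` mpolys S"
  by (auto simp: polyring_def mpolys_def)

lemma meval_monomial:
  assumes "ring_hom emb"
  shows "meval emb x (\<Prod>l\<in>S. Var l ^ e l) = (\<Prod>l\<in>S. x l ^ e l)"
  by (simp add: ring_hom_prod[OF ring_hom_meval[OF assms]] ring_homD[OF ring_hom_meval[OF assms]]
      meval_Var[OF assms])

lemma monomial_in_mpolys: "S \<subseteq> W \<Longrightarrow> (\<Prod>l\<in>S. Var l ^ e l) \<in> mpolys W"
  by (auto intro!: is_subring_prod[OF is_subring_mpolys] mpolys_closed Var_in_mpolys)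

lemma Var_neq_0: "Var l \<noteq> (0 :: 'a::idom mpoly)"
  using prime_elem_Var[of l] by (auto simp: prime_elem_def)

lemma alg_indep_inject:
  fixes x :: "nat \<Rightarrow> 'k::field"
  assumes "ring_hom emb" "alg_indep emb n x" "p \<in> mpolys {..<n}" "q \<in> mpolys {..<n}"
    "meval emb x p = meval emb x q"
  shows "p = q"
proof -
  have "p - q \<in> mpolys {..<n}"
    using assms by (simp add: mpolys_closed)
  then have "p - q = 0"
    using assms by (auto simp: alg_indep_def mpolys_def ring_homD[OF ring_hom_meval[OF assms(1)]])
  then show ?thesis by simp
qed

lemma alg_indep_nonzero:
  fixes x :: "nat \<Rightarrow> 'k::field" and p :: "'a::comm_ring_1 mpoly"
  assumes "ring_hom emb" "alg_indep emb n x" "p \<in> mpolys {..<n}" "p \<noteq> 0"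
  shows "meval emb x p \<noteq> 0"
  using assms by (auto simp: alg_indep_def mpolys_def)

lemma alg_indep_var_nonzero:
  fixes emb :: "'a::idom \<Rightarrow> 'k::field"
  assumes "ring_hom emb" "alg_indep emb n x" "l < n"
  shows "x l \<noteq> 0"
  using alg_indep_nonzero[OF assms(1,2), of "Var l"] assms(3)
  by (simp add: Var_in_mpolys Var_neq_0 meval_Var[OF assms(1)])

lemma laurentI:
  "p \<in> mpolys S \<Longrightarrow> y = meval emb x p / (\<Prod>j\<in>S. x j ^ e j) \<Longrightarrow> y \<in> laurent emb S x"
  by (auto simp: laurent_def mpolys_def)

lemma laurent_polynomial:
  "p \<in> mpolys S \<Longrightarrow> meval emb x p \<in> laurent emb S x"
  by (rule laurentI[where e = "\<lambda>_. 0"]) auto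

lemma is_subring_laurent:
  fixes emb :: "'a::comm_ring_1 \<Rightarrow> 'k::field"
  assumes emb: "ring_hom emb" and "finite S" and nz: "\<And>l. l \<in> S \<Longrightarrow> x l \<noteq> 0"
  shows "is_subring (laurent emb S x)"
  unfolding is_subring_def
proof (intro conjI ballI)
  note hom = ring_homD[OF ring_hom_meval[OF emb]]
  show "1 \<in> laurent emb S x"
    using laurent_polynomial[of 1 S emb x] by (simp add: hom mpolys_closed)
  fix y z assume "y \<in> laurent emb S x" "z \<in> laurent emb S x"
  then obtain p q e f where y: "y = meval emb x p / (\<Prod>j\<in>S. x j ^ e j)" "p \<in> mpolys S"
    and z: "z = meval emb x q / (\<Prod>j\<in>S. x j ^ f j)" "q \<in> mpolys S"
    by (auto simp: laurent_def mpolys_def)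
  have nz': "(\<Prod>j\<in>S. x j ^ g j) \<noteq> 0" for g :: "nat \<Rightarrow> nat"
    using nz \<open>finite S\<close> by auto
  have split: "(\<Prod>j\<in>S. x j ^ (e j + f j)) = (\<Prod>j\<in>S. x j ^ e j) * (\<Prod>j\<in>S. x j ^ f j)"
    by (simp add: power_add prod.distrib)
  let ?m = "\<lambda>g. \<Prod>j\<in>S. Var j ^ g j"
  show "y * z \<in> laurent emb S x"
    by (rule laurentI[where e = "\<lambda>j. e j + f j" and p = "p * q"])
       (use y z split in \<open>auto simp: mpolys_closed hom\<close>)
  show "y - z \<in> laurent emb S x"
    by (rule laurentI[where e = "\<lambda>j. e j + f j" and p = "p * ?m f - q * ?m e"])
       (use y z split nz' in \<open>auto simp: mpolys_closed hom monomial_in_mpolys meval_monomial[OF emb] diff_frac_eq\<close>)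
qed

lemma laurent_const: "ring_hom emb \<Longrightarrow> emb c \<in> laurent emb S x"
  using laurent_polynomial[of "Const c" S emb x] by (simp add: Const_in_mpolys meval_Const)

lemma laurent_var: "ring_hom emb \<Longrightarrow> l \<in> S \<Longrightarrow> x l \<in> laurent emb S x"
  using laurent_polynomial[of "Var l" S emb x] by (simp add: Var_in_mpolys meval_Var)

lemma laurent_var_inverse:
  assumes "ring_hom emb" "finite S" "l \<in> S"
  shows "inverse (x l) \<in> laurent emb S x"
proof (rule laurentI[where e = "\<lambda>j. if j = l then 1 else 0" and p = 1])
  have "(\<Prod>j\<in>S. x j ^ (if j = l then 1 else 0)) = (\<Prod>j\<in>S. if j = l then x j else 1)"
    by (rule prod.cong) auto
  then show "inverse (x l) = meval emb x 1 / (\<Prod>j\<in>S. x j ^ (if j = l then 1 else 0))"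
    using assms by (simp add: ring_homD[OF ring_hom_meval] inverse_eq_divide)
qed (simp add: mpolys_closed)

lemma laurent_subset:
  assumes "is_subring T" "\<And>c. emb c \<in> T" "\<And>l. l \<in> S \<Longrightarrow> x l \<in> T" "\<And>l. l \<in> S \<Longrightarrow> inverse (x l) \<in> T"
  shows "laurent emb S x \<subseteq> T"
proof
  fix y assume "y \<in> laurent emb S x"
  then obtain p e where y: "y = meval emb x p / (\<Prod>j\<in>S. x j ^ e j)" "vars p \<subseteq> S"
    by (auto simp: laurent_def)
  have "y = meval emb x p * (\<Prod>j\<in>S. inverse (x j) ^ e j)"
    by (simp add: y divide_inverse power_inverse prod_inversef[symmetric] comp_def)
  also have "\<dots> \<in> T"
    by (intro is_subringD[OF assms(1)] meval_in_subring[OF assms(1)] is_subring_prod[OF assms(1)])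
       (use assms y in auto)
  finally show "y \<in> T" .
qed

section \<open>Rescaling and exchanging one cluster variable\<close>

lemma laurent_scale_subset:
  fixes emb :: "'a::comm_ring_1 \<Rightarrow> 'k::field"
  assumes emb: "ring_hom emb" and "finite S" and nz: "\<And>l. l \<in> S \<Longrightarrow> l \<noteq> j \<Longrightarrow> x l \<noteq> 0"
    and "z \<noteq> 0" and w: "w \<in> laurent emb (S - {j}) x" "inverse w \<in> laurent emb (S - {j}) x"
  shows "laurent emb S (x(j := w * z)) \<subseteq> laurent emb S (x(j := z))"
proof -
  let ?B = "laurent emb S (x(j := z))"
  have B: "is_subring ?B"
    by (rule is_subring_laurent[OF emb]) (use assms in auto)
  have gen: "(x(j := z)) l \<in> ?B" "inverse ((x(j := z)) l) \<in> ?B" if "l \<in> S" for l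
    using laurent_var[OF emb that] laurent_var_inverse[OF emb \<open>finite S\<close> that] by blast+
  have sub: "laurent emb (S - {j}) x \<subseteq> ?B"
  proof (rule laurent_subset[OF B laurent_const[OF emb]])
    fix l assume "l \<in> S - {j}"
    then show "x l \<in> ?B" "inverse (x l) \<in> ?B"
      using gen[of l] by auto
  qed
  show ?thesis
  proof (rule laurent_subset[OF B laurent_const[OF emb]])
    fix l assume "l \<in> S"
    then show "(x(j := w * z)) l \<in> ?B" "inverse ((x(j := w * z)) l) \<in> ?B"
      using gen[of l] sub w is_subringD(6)[OF B] by (auto simp: subset_iff split: if_splits)
  qed
qed

text \<open>A unit \<open>w\<close> of the Laurent ring in the other variables is absorbed by the
  exchanged variable. This disposes of the denominators of \<open>hatF\<close> and of unit
  constants; the reverse inclusion scales back by \<open>inverse w\<close>.\<close>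

lemma laurent_scale:
  fixes emb :: "'a::comm_ring_1 \<Rightarrow> 'k::field"
  assumes "ring_hom emb" "finite S" "\<And>l. l \<in> S \<Longrightarrow> l \<noteq> j \<Longrightarrow> x l \<noteq> 0"
    and "z \<noteq> 0" "w \<noteq> 0" "w \<in> laurent emb (S - {j}) x" "inverse w \<in> laurent emb (S - {j}) x"
  shows "laurent emb S (x(j := w * z)) = laurent emb S (x(j := z))"
proof
  show "laurent emb S (x(j := z)) \<subseteq> laurent emb S (x(j := w * z))"
    using laurent_scale_subset[of emb S j x "w * z" "inverse w"] assms by (simp flip: mult.assoc)
qed (use laurent_scale_subset[OF assms(1-4,6,7)] in auto)

text \<open>The polynomial obtained from \<open>g\<close> by substituting \<open>Q/x\<^sub>j\<close> for \<open>x\<^sub>j\<close> and clearing denominators.\<close>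

definition homogenized :: "nat \<Rightarrow> 'a::comm_ring_1 mpoly \<Rightarrow> 'a mpoly \<Rightarrow> 'a mpoly" where
  "homogenized j Q g = (\<Sum>i\<le>degree (as_poly j g). cf j g i * Q ^ i * Var j ^ (degree (as_poly j g) - i))"

lemma not_in_mpolys_Diff: "p \<in> mpolys (W - {j}) \<Longrightarrow> j \<notin> vars p"
  by (auto simp: mpolys_def)

lemma mpolys_mono: "V \<subseteq> W \<Longrightarrow> p \<in> mpolys V \<Longrightarrow> p \<in> mpolys W"
  by (auto simp: mpolys_def)

lemma meval_upd_not_in_vars: "j \<notin> vars p \<Longrightarrow> meval h (x(j := z)) p = meval h x p"
  by (rule meval_cong) auto

lemma meval_upd_eq_sum_cf:
  assumes "ring_hom h"
  shows "meval h (x(j := z)) p = (\<Sum>i\<le>degree (as_poly j p). meval h x (cf j p i) * z ^ i)"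
proof -
  have "j \<notin> vars (cf j p i)" for i
    using cf_in_mpolys[of p UNIV j i] by (auto simp: mpolys_def)
  then show ?thesis
    by (simp add: meval_eq_sum_cf[OF assms, of _ p j] meval_upd_not_in_vars)
qed

lemma meval_homogenized:
  fixes x :: "nat \<Rightarrow> 'k::field"
  assumes emb: "ring_hom emb" and "x j \<noteq> 0"
  shows "meval emb x (homogenized j Q g) =
    meval emb (x(j := meval emb x Q / x j)) g * x j ^ degree (as_poly j g)"
proof -
  have "meval emb x (cf j g i) * meval emb x Q ^ i * x j ^ (degree (as_poly j g) - i) =
      meval emb x (cf j g i) * (meval emb x Q / x j) ^ i * x j ^ degree (as_poly j g)"
    if "i \<le> degree (as_poly j g)" for i
    using that assms(2) by (simp add: power_diff power_divide)
  then have "(\<Sum>i\<le>degree (as_poly j g). meval emb x (cf j g i) * meval emb x Q ^ i *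
      x j ^ (degree (as_poly j g) - i)) = (\<Sum>i\<le>degree (as_poly j g). meval emb x (cf j g i) *
      (meval emb x Q / x j) ^ i * x j ^ degree (as_poly j g))"
    by (intro sum.cong) auto
  then show ?thesis
    unfolding meval_upd_eq_sum_cf[OF emb] homogenized_def sum_distrib_right meval_sum[OF emb]
    by (simp only: meval_mult[OF emb] meval_Var[OF emb] ring_homD(7)[OF ring_hom_meval[OF emb]])
qed

lemma as_poly_homogenized:
  assumes "j \<notin> vars Q"
  shows "as_poly j (homogenized j Q g) =
    (\<Sum>i\<le>degree (as_poly j g). monom (cf j g i * Q ^ i) (degree (as_poly j g) - i))"
proof -
  have v: "j \<notin> vars (cf j g i)" for i
    using cf_in_mpolys[of g UNIV j i] by (auto simp: mpolys_def)
  show ?thesis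
    unfolding homogenized_def
    by (simp add: ring_hom_sum[OF ring_hom_as_poly] as_poly_simps as_poly_not_in_vars[OF v]
        as_poly_not_in_vars[OF assms] as_poly_Var monom_altdef poly_const_pow mult.commute)
qed

text \<open>Substituting \<open>Q\<close> over x_j reverses the order of the coefficients, each
  keeping the power of \<open>Q\<close> that belongs to its old degree. These powers produce the
  divisibility conditions in \<open>adic\<close>.\<close>

lemma cf_homogenized:
  assumes "j \<notin> vars Q"
  shows "cf j (homogenized j Q g) t =
    (if t \<le> degree (as_poly j g) then cf j g (degree (as_poly j g) - t) * Q ^ (degree (as_poly j g) - t) else 0)"
proof -
  have "cf j (homogenized j Q g) t =
      (\<Sum>i\<le>degree (as_poly j g). if degree (as_poly j g) - i = t then cf j g i * Q ^ i else 0)"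
    unfolding as_poly_homogenized[OF assms] coeff_sum by simp
  also have "\<dots> = (\<Sum>i\<le>degree (as_poly j g). if i = degree (as_poly j g) - t \<and> t \<le> degree (as_poly j g)
      then cf j g i * Q ^ i else 0)"
    by (rule sum.cong) auto
  finally show ?thesis by auto
qed

lemma homogenized_in_mpolys:
  "Q \<in> mpolys W \<Longrightarrow> g \<in> mpolys W \<Longrightarrow> j \<in> W \<Longrightarrow> homogenized j Q g \<in> mpolys W"
  unfolding homogenized_def
  by (intro is_subring_sum[OF is_subring_mpolys] mpolys_closed Var_in_mpolys
      mpolys_mono[OF Diff_subset cf_in_mpolys])

text \<open>After clearing denominators, a relation for the new cluster becomes a relation for the
  old one.\<close>

lemma alg_indep_exchange:
  fixes emb :: "'a::idom \<Rightarrow> 'k::field"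
  assumes emb: "ring_hom emb" and x: "alg_indep emb n x" and "k < n"
    and P: "P \<in> mpolys ({..<n} - {k})" "P \<noteq> 0"
  shows "alg_indep emb n (x(k := meval emb x P / x k))"
  unfolding alg_indep_def
proof (intro allI impI)
  fix g :: "'a mpoly" assume g: "vars g \<subseteq> {..<n}" "meval emb (x(k := meval emb x P / x k)) g = 0"
  have "homogenized k P g \<in> mpolys {..<n}"
    using g P \<open>k < n\<close> by (intro homogenized_in_mpolys) (auto simp: mpolys_def)
  moreover have "meval emb x (homogenized k P g) = 0"
    using meval_homogenized[of emb x k P g] alg_indep_var_nonzero[OF emb x \<open>k < n\<close>] emb g by simp
  ultimately have h0: "homogenized k P g = 0"
    using x by (auto simp: alg_indep_def mpolys_def)
  \<comment> \<open>The coefficient of degree 0 of the homogenized polynomial is the leading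
    coefficient of \<open>g\<close> times a power of \<open>P\<close>.\<close>
  have "cf k g (degree (as_poly k g)) * P ^ degree (as_poly k g) = 0"
    using cf_homogenized[OF not_in_mpolys_Diff[OF P(1)], of g 0] h0 by (simp add: as_poly_simps)
  then show "g = 0"
    using P by (simp add: as_poly_eq_0_iff)
qed

text \<open>Membership in the \<open>L\<close>-th power of the ideal generated by \<open>Q\<close> and \<open>x\<^sub>j\<close>,
  for a polynomial \<open>Q\<close> not involving \<open>x\<^sub>j\<close>.\<close>

definition adic :: "nat \<Rightarrow> 'a::comm_ring_1 mpoly \<Rightarrow> nat \<Rightarrow> 'a mpoly \<Rightarrow> bool" where
  "adic j Q L f \<longleftrightarrow> (\<forall>i<L. Q ^ (L - i) dvd cf j f i)"

text \<open>Modulo x_j the factor \<open>c\<close> is just \<open>cf j c 0\<close>, which is coprime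
  to \<open>Q\<close> in the sense of \<open>cop\<close>. The coefficients of \<open>f\<close> are
  treated in increasing order.\<close>

lemma adic_mult_cancel:
  fixes c :: "'a::idom mpoly"
  assumes cop: "\<And>m z. Q ^ m dvd cf j c 0 * z \<Longrightarrow> Q ^ m dvd z" and cf: "adic j Q L (c * f)"
  shows "adic j Q L f"
proof -
  have "Q ^ (L - i) dvd cf j f i" if "i < L" for i
    using that
  proof (induction i rule: less_induct)
    case (less i)
    have "cf j (c * f) i = (\<Sum>l\<le>i. cf j c l * cf j f (i - l))"
      by (simp add: as_poly_simps coeff_mult)
    also have "\<dots> = cf j c 0 * cf j f i + (\<Sum>l\<in>{..i} - {0}. cf j c l * cf j f (i - l))"
      by (subst sum.remove[of _ 0]) auto
    finally have eq: "cf j (c * f) i = \<dots>" .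
    \<comment> \<open>The terms with \<open>l > 0\<close> contain earlier coefficients of
      \<open>f\<close>, which by induction are divisible by a higher power of
      \<open>Q\<close>.\<close>
    have "Q ^ (L - i) dvd (\<Sum>l\<in>{..i} - {0}. cf j c l * cf j f (i - l))"
    proof (rule dvd_sum)
      fix l assume "l \<in> {..i} - {0}"
      then have "Q ^ (L - (i - l)) dvd cf j f (i - l)"
        using less.IH[of "i - l"] less.prems by simp
      moreover have "Q ^ (L - i) dvd Q ^ (L - (i - l))"
        by (rule le_imp_power_dvd) auto
      ultimately show "Q ^ (L - i) dvd cf j c l * cf j f (i - l)"
        using dvd_trans dvd_mult by blast
    qed
    moreover have "Q ^ (L - i) dvd cf j (c * f) i"
      using cf less.prems by (auto simp: adic_def)
    ultimately have "Q ^ (L - i) dvd cf j c 0 * cf j f i"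
      unfolding eq by (simp add: dvd_add_left_iff)
    then show ?case
      by (rule cop)
  qed
  then show ?thesis
    by (auto simp: adic_def)
qed

lemma adic_power_mult_cancel:
  fixes c :: "'a::idom mpoly"
  assumes "\<And>m z. Q ^ m dvd cf j c 0 * z \<Longrightarrow> Q ^ m dvd z" "adic j Q L (c ^ M * f)"
  shows "adic j Q L f"
  using assms(2) by (induction M) (auto simp: mult.assoc intro: adic_mult_cancel[OF assms(1)])

text \<open>A coefficient \<open>Q ^ (L - i) * g\<close> of degree \<open>i\<close> contributes
  \<open>g\<close> times the power \<open>L - i\<close> of \<open>Q\<close> over x_j. The ring
  \<open>T\<close> is left abstract because it will be an exchanged Laurent ring or a localization
  of one.\<close>

lemma adic_imp_in_subring:
  fixes emb :: "'a::idom \<Rightarrow> 'k::field"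
  assumes emb: "ring_hom emb" and T: "is_subring T" "\<And>c. emb c \<in> T" "\<And>l. l \<in> W \<Longrightarrow> x l \<in> T"
    and "meval emb x Q / x j \<in> T" "x j \<noteq> 0" "f \<in> mpolys W" "j \<in> W" "adic j Q L f"
  shows "meval emb x f / x j ^ L \<in> T"
proof -
  note hom = ring_homD[OF ring_hom_meval[OF emb]]
  have in_T: "meval emb x p \<in> T" if "p \<in> mpolys W" for p
    by (rule meval_in_subring[OF T(1,2)]) (use that T in \<open>auto simp: mpolys_def\<close>)
  have cf_W: "cf j f i \<in> mpolys W" for i
    using cf_in_mpolys[OF assms(7), of j i] by (auto simp: mpolys_def)
  have "meval emb x (cf j f i) * x j ^ i / x j ^ L \<in> T" for i
  proof (cases "i < L")
    case False
    then have "meval emb x (cf j f i) * x j ^ i / x j ^ L = meval emb x (cf j f i) * x j ^ (i - L)"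
      using assms(6) by (simp add: power_diff)
    then show ?thesis
      using is_subringD[OF T(1)] in_T[OF cf_W] T(3)[OF \<open>j \<in> W\<close>] by simp
  next
    case True
    then obtain g where g: "cf j f i = Q ^ (L - i) * g"
      using assms(9) unfolding adic_def dvd_def by blast
    show ?thesis
    \<comment> \<open>A zero product says nothing about the variables of the cofactor
      \<open>g\<close>, so this case is separated.\<close>
    proof (cases "cf j f i = 0")
      case True
      then show ?thesis
        using is_subringD[OF T(1)] by (simp add: hom)
    next
      case False
      then have "g \<in> mpolys W"
        using cf_W[of i] factors_in_mpolys(2)[of "Q ^ (L - i)" g] g by simp
      have L: "x j ^ L = x j ^ (L - i) * x j ^ i"
        using True by (simp flip: power_add)
      have "meval emb x (cf j f i) * x j ^ i / x j ^ L = (meval emb x Q / x j) ^ (L - i) * meval emb x g"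
        unfolding L using assms(6) by (simp add: g hom power_divide)
      then show ?thesis
        using is_subringD[OF T(1)] in_T[OF \<open>g \<in> mpolys W\<close>] assms by simp
    qed
  qed
  then show ?thesis
    unfolding meval_eq_sum_cf[OF emb, of x f j] sum_divide_distrib
    by (intro is_subring_sum[OF T(1)])
qed

text \<open>Being prime, \<open>q\<close> divides one of the variables and is therefore an associate
  of it. The conclusion has the variable dividing \<open>q\<close>, so that it excludes
  \<open>q\<close> as a factor of a polynomial divisible by no variable.\<close>

lemma irreducible_dvd_monomial:
  fixes q :: "'a::{factorial_semiring, idom} mpoly"
  assumes "irreducible q" "q dvd (\<Prod>l\<in>S. Var l ^ e l)" "finite S"
  shows "\<exists>l\<in>S. Var l dvd q"
  using assms(3,2)
proof (induction S)
  case empty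
  then show ?case
    using assms(1) by (auto simp: irreducible_def)
next
  case (insert l S)
  then have "q dvd Var l ^ e l * (\<Prod>l\<in>S. Var l ^ e l)" by simp
  then consider "q dvd Var l ^ e l" | "q dvd (\<Prod>l\<in>S. Var l ^ e l)"
    using prime_elem_dvd_multD[OF irreducible_imp_prime_elem_mpoly[OF assms(1)]] by blast
  then show ?case
  proof cases
    case 1
    then have "q dvd Var l"
      using prime_elem_dvd_power[OF irreducible_imp_prime_elem_mpoly[OF assms(1)]] by blast
    then obtain t where t: "Var l = q * t" by (rule dvdE)
    have "Var l dvd q \<or> Var l dvd t"
      using prime_elem_dvd_multD[OF prime_elem_Var, of l q t] t by simp
    moreover have False if "Var l dvd t"
    proof -
      from that obtain s where "t = Var l * s" by (rule dvdE)
      with t have "Var l * 1 = Var l * (q * s)" by (simp add: mult_ac)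
      then have "q * s = 1"
        using Var_neq_0[of l] by (metis mult_left_cancel)
      then have "q dvd 1" by (metis dvd_triv_left)
      then show False
        using assms(1) by (auto simp: irreducible_def)
    qed
    ultimately show ?thesis by blast
  qed (use insert in auto)
qed

text \<open>Clearing denominators turns membership into an identity of polynomials. Comparing
  coefficients in x_j yields powers of \<open>Q\<close>, and the monomial in the other variables
  cancels because no variable divides \<open>Q\<close>.\<close>

lemma in_exchanged_laurent_imp_adic:
  fixes emb :: "'a::{factorial_semiring, idom} \<Rightarrow> 'k::field"
  assumes emb: "ring_hom emb" and x: "alg_indep emb n x" and "j < n"
    and Q: "Q \<in> mpolys ({..<n} - {j})" "Q \<noteq> 0" "\<And>l. \<not> Var l dvd Q"
    and f: "f \<in> mpolys {..<n}"
    and y: "meval emb x f / x j ^ L \<in> laurent emb {..<n} (x(j := meval emb x Q / x j))"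
  shows "adic j Q L f"
  unfolding adic_def
proof (intro allI impI)
  note hom = ring_homD[OF ring_hom_meval[OF emb]]
  fix s assume "s < L"
  define x' where "x' = x(j := meval emb x Q / x j)"
  obtain g e where g: "g \<in> mpolys {..<n}" and
    eq: "meval emb x f / x j ^ L = meval emb x' g / (\<Prod>l<n. x' l ^ e l)"
    using y by (auto simp: laurent_def mpolys_def x'_def)
  \<comment> \<open>The exponent of the exchanged variable in the denominator; it is the source of
    the factor \<open>Q ^ N\<close> below.\<close>
  define N where "N = e j"
  define d where "d = degree (as_poly j g)"
  define mon :: "'a mpoly" where "mon = (\<Prod>l\<in>{..<n} - {j}. Var l ^ e l)"
  have b0: "x j \<noteq> 0"
    by (rule alg_indep_var_nonzero[OF emb x \<open>j < n\<close>])
  have Q': "Q \<in> mpolys {..<n}" using Q by (auto simp: mpolys_def)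
  have Q0: "meval emb x Q \<noteq> 0"
    by (rule alg_indep_nonzero[OF emb x Q' Q(2)])
  have mon: "mon \<in> mpolys {..<n}" "j \<notin> vars mon"
    using monomial_in_mpolys[of "{..<n} - {j}" "{..<n} - {j}" e]
    by (auto simp: mon_def mpolys_def)
  have mon0: "mon \<noteq> 0"
    by (simp add: mon_def Var_neq_0)
  have "(\<Prod>l<n. x' l ^ e l) = x' j ^ N * (\<Prod>l\<in>{..<n} - {j}. x' l ^ e l)"
    using \<open>j < n\<close> by (simp add: prod.remove[of _ j] N_def)
  also have "(\<Prod>l\<in>{..<n} - {j}. x' l ^ e l) = meval emb x mon"
    unfolding mon_def meval_monomial[OF emb] by (rule prod.cong) (auto simp: x'_def)
  finally have "meval emb x f * ((meval emb x Q / x j) ^ N * meval emb x mon) = x j ^ L * meval emb x' g"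
    using eq b0 Q0 alg_indep_nonzero[OF emb x mon(1) mon0]
    by (simp add: x'_def frac_eq_eq mult_ac)
  then have "meval emb x f * meval emb x Q ^ N * meval emb x mon = meval emb x' g * x j ^ (L + N)"
    using b0 by (simp add: power_divide power_add field_simps)
  then have "meval emb x (f * Q ^ N * mon * Var j ^ d) = meval emb x (homogenized j Q g * Var j ^ (L + N))"
    using meval_homogenized[of emb x j Q g, OF emb b0]
    by (simp add: hom meval_Var[OF emb] x'_def d_def mult_ac)
  then have "f * Q ^ N * mon * Var j ^ d = homogenized j Q g * Var j ^ (L + N)"
    using \<open>j < n\<close> f g Q' mon
    by (intro alg_indep_inject[OF emb x])
       (auto intro!: mpolys_closed Var_in_mpolys homogenized_in_mpolys)
  moreover have "as_poly j (p * Var j ^ r) = monom 1 r * as_poly j p" for p :: "'a mpoly" and r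
    by (simp add: as_poly_simps as_poly_Var monom_altdef mult.commute)
  ultimately have eq2: "monom 1 d * as_poly j (f * Q ^ N * mon) =
      monom 1 (L + N) * as_poly j (homogenized j Q g)"
    by metis
  have vQN: "j \<notin> vars Q"
    using Q by (auto simp: mpolys_def)
  \<comment> \<open>Compare coefficients of degree \<open>d + s\<close>: on the left the shift by
    \<open>d\<close> leaves the coefficient of degree \<open>s\<close> of \<open>f\<close> times
    factors free of x_j.\<close>
  have "cf j f s * (Q ^ N * mon) = coeff (monom 1 d * as_poly j (f * Q ^ N * mon)) (d + s)"
    unfolding coeff_monom_mult
    by (simp add: as_poly_simps as_poly_not_in_vars[OF vQN]
        as_poly_not_in_vars[OF mon(2)] poly_const_pow mult_ac)
  also have "\<dots> = coeff (monom 1 (L + N) * as_poly j (homogenized j Q g)) (d + s)"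
    by (simp only: eq2)
  finally have "cf j f s * (Q ^ N * mon) = \<dots>" .
  \<comment> \<open>On the right the index into the homogenized polynomial is
    \<open>t = d + s - (L + N)\<close>, and its coefficient carries \<open>Q ^ (d - t)\<close> with
    \<open>d - t = L - s + N\<close>. If \<open>L + N\<close> exceeds \<open>d + s\<close>, the
    coefficient is 0.\<close>
  moreover have "Q ^ (L - s + N) dvd \<dots>"
  proof (cases "L + N \<le> d + s")
    case True
    then have "L - s + N = d - (d + s - (L + N))" "d + s - (L + N) \<le> d"
      using \<open>s < L\<close> by auto
    then show ?thesis
      unfolding coeff_monom_mult cf_homogenized[OF vQN] d_def[symmetric] by simp
  qed (simp add: coeff_monom_mult)
  ultimately have "Q ^ (L - s) * Q ^ N dvd mon * cf j f s * Q ^ N"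
    by (simp add: power_add mult_ac)
  then have "Q ^ (L - s) dvd mon * cf j f s"
    using Q(2) by (subst (asm) dvd_mult_cancel_right) simp
  then show "Q ^ (L - s) dvd cf j f s"
  proof (rule power_dvd_mult_cancel[OF mon0, rotated])
    fix q assume "irreducible q" "q dvd mon"
    then obtain l where "Var l dvd q"
      unfolding mon_def by (auto dest: irreducible_dvd_monomial)
    then show "\<not> q dvd Q"
      using Q(3) dvd_trans by blast
  qed
qed

text \<open>For nonzero \<open>c\<close> in a subring \<open>B\<close> this is the localization of
  \<open>B\<close> at the powers of \<open>c\<close>, taken inside the field.\<close>

definition saturation :: "'k::field set \<Rightarrow> 'k \<Rightarrow> 'k set" where
  "saturation B c = {z. \<exists>M. c ^ M * z \<in> B}"

lemma is_subring_saturation: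
  assumes B: "is_subring B" and c: "c \<in> B"
  shows "is_subring (saturation B c)"
  unfolding is_subring_def
proof (intro conjI ballI)
  note closed = is_subringD[OF B]
  show "1 \<in> saturation B c"
    using closed by (auto simp: saturation_def intro: exI[of _ 0])
  fix a b assume "a \<in> saturation B c" "b \<in> saturation B c"
  then obtain M N where MN: "c ^ M * a \<in> B" "c ^ N * b \<in> B"
    by (auto simp: saturation_def)
  have "c ^ (M + N) * (a * b) = (c ^ M * a) * (c ^ N * b)"
    by (simp add: power_add mult_ac)
  then show "a * b \<in> saturation B c"
    using MN closed unfolding saturation_def by (metis (mono_tags, lifting) mem_Collect_eq)
  have "c ^ (M + N) * (a - b) = c ^ N * (c ^ M * a) - c ^ M * (c ^ N * b)"
    by (simp add: power_add algebra_simps)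
  moreover have "\<dots> \<in> B"
    using MN c closed by simp
  ultimately show "a - b \<in> saturation B c"
    unfolding saturation_def by (metis (mono_tags, lifting) mem_Collect_eq)
qed

lemma subset_saturation: "z \<in> B \<Longrightarrow> z \<in> saturation B c"
  by (auto simp: saturation_def intro: exI[of _ 0])

lemma saturationI: "c * z \<in> B \<Longrightarrow> z \<in> saturation B c"
  by (auto simp: saturation_def intro: exI[of _ 1])

lemma power_int_in_subring:
  fixes z :: "'k::field"
  assumes "is_subring B" "z \<in> B" "inverse z \<in> B"
  shows "z powi e \<in> B"
  using is_subringD(7)[OF assms(1)] assms by (auto simp: power_int_def)

text \<open>Separates x_j from the other variables, which stay invertible when x_j is
  exchanged.\<close>

lemma laurent_split_denominator:
  assumes "y \<in> laurent emb {..<n} x" "j < n"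
  obtains f L e where "f \<in> mpolys {..<n}"
    "y = meval emb x f / x j ^ L * (\<Prod>l\<in>{..<n} - {j}. inverse (x l) ^ e l)"
proof -
  obtain f e where f: "f \<in> mpolys {..<n}" "y = meval emb x f / (\<Prod>l<n. x l ^ e l)"
    using assms by (auto simp: laurent_def mpolys_def)
  have "(\<Prod>l<n. x l ^ e l) = x j ^ e j * (\<Prod>l\<in>{..<n} - {j}. x l ^ e l)"
    using assms by (simp add: prod.remove)
  then have "y = meval emb x f / x j ^ e j * (\<Prod>l\<in>{..<n} - {j}. inverse (x l) ^ e l)"
    by (simp add: f divide_inverse power_inverse prod_inversef[symmetric] comp_def)
  with f that show ?thesis by blast
qed

lemma exchanged_laurent_generators:
  fixes emb :: "'a::idom \<Rightarrow> 'k::field"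
  assumes emb: "ring_hom emb" and x: "alg_indep emb n x" and "j < n"
    and Q: "Q \<in> mpolys ({..<n} - {j})" "Q \<noteq> 0"
  defines "B \<equiv> laurent emb {..<n} (x(j := meval emb x Q / x j))"
  shows "is_subring B" "l < n \<Longrightarrow> x l \<in> B" "l < n \<Longrightarrow> l \<noteq> j \<Longrightarrow> inverse (x l) \<in> B"
    "meval emb x Q / x j \<in> B"
proof -
  have Q0: "meval emb x Q \<noteq> 0"
    by (rule alg_indep_nonzero[OF emb x]) (use Q in \<open>auto simp: mpolys_def\<close>)
  show B: "is_subring B"
    unfolding B_def
    by (rule is_subring_laurent[OF emb])
       (use alg_indep_var_nonzero[OF emb x] \<open>j < n\<close> Q0 in auto)
  have gen: "x l \<in> B" "inverse (x l) \<in> B" if "l < n" "l \<noteq> j" for l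
    using laurent_var[OF emb, of l "{..<n}" "x(j := meval emb x Q / x j)"]
      laurent_var_inverse[OF emb, of "{..<n}" l "x(j := meval emb x Q / x j)"] that
    by (simp_all add: B_def)
  show "meval emb x Q / x j \<in> B"
    using laurent_var[OF emb, of j "{..<n}" "x(j := meval emb x Q / x j)"] \<open>j < n\<close>
    by (simp add: B_def)
  \<comment> \<open>x_j is recovered as \<open>Q\<close> times the inverse of the exchanged
    variable, and \<open>Q\<close> involves only the other variables.\<close>
  have "x j / meval emb x Q \<in> B"
    using laurent_var_inverse[OF emb, of "{..<n}" j "x(j := meval emb x Q / x j)"] \<open>j < n\<close>
    by (simp add: B_def)
  moreover have "meval emb x Q \<in> B"
    by (rule meval_in_subring[OF B])
       (use Q gen laurent_const[OF emb] in \<open>auto simp: mpolys_def B_def\<close>)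
  ultimately have "x j \<in> B"
    using is_subringD(6)[OF B, of "meval emb x Q" "x j / meval emb x Q"] Q0 by simp
  then show "x l \<in> B" if "l < n"
    using gen that by (cases "l = j") auto
  show "inverse (x l) \<in> B" if "l < n" "l \<noteq> j"
    using gen that by blast
qed

text \<open>By the adic criterion, the intersection of the two Laurent rings is generated over R by
  x_j, the exchanged variable, and the other variables with their inverses. So only these have to
  lie in \<open>T\<close>.\<close>

lemma in_exchanged_laurent_imp_in_subring:
  fixes emb :: "'a::{factorial_semiring, idom} \<Rightarrow> 'k::field"
  assumes emb: "ring_hom emb" and x: "alg_indep emb n x" and "j < n"
    and Q: "Q \<in> mpolys ({..<n} - {j})" "Q \<noteq> 0" "\<And>l. \<not> Var l dvd Q"
    and y: "y \<in> laurent emb {..<n} x" "y \<in> laurent emb {..<n} (x(j := meval emb x Q / x j))"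
    and T: "is_subring T" "\<And>c. emb c \<in> T" "\<And>l. l < n \<Longrightarrow> x l \<in> T"
      "\<And>l. l < n \<Longrightarrow> l \<noteq> j \<Longrightarrow> inverse (x l) \<in> T" "meval emb x Q / x j \<in> T"
  shows "y \<in> T"
proof -
  obtain f L e where f: "f \<in> mpolys {..<n}"
    and yf: "y = meval emb x f / x j ^ L * (\<Prod>l\<in>{..<n} - {j}. inverse (x l) ^ e l)"
    using laurent_split_denominator[OF y(1) \<open>j < n\<close>] by metis
  let ?B = "laurent emb {..<n} (x(j := meval emb x Q / x j))"
  let ?mon = "\<Prod>l\<in>{..<n} - {j}. x l ^ e l"
  have nz: "x l \<noteq> 0" if "l < n" for l
    using alg_indep_var_nonzero[OF emb x that] .
  note gens = exchanged_laurent_generators[OF emb x \<open>j < n\<close> Q(1,2)]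
  note B = gens(1)
  have "(\<Prod>l\<in>{..<n} - {j}. inverse (x l) ^ e l) * ?mon = 1"
    unfolding prod.distrib[symmetric] using nz by (intro prod.neutral) (auto simp flip: power_mult_distrib)
  then have "meval emb x f / x j ^ L = y * ?mon"
    by (simp add: yf mult.assoc)
  moreover have "?mon \<in> ?B"
    by (intro is_subring_prod[OF B] is_subringD[OF B] gens) auto
  ultimately have "meval emb x f / x j ^ L \<in> ?B"
    using y(2) is_subringD[OF B] by simp
  then have "adic j Q L f"
    by (rule in_exchanged_laurent_imp_adic[OF emb x \<open>j < n\<close> Q f])
  then have "meval emb x f / x j ^ L \<in> T"
    by (intro adic_imp_in_subring[OF emb T(1,2) _ T(5) _ f]) (use T nz \<open>j < n\<close> in auto)
  then show ?thesis
    unfolding yf by (intro is_subringD[OF T(1)] is_subring_prod[OF T(1)]) (use T in auto)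
qed

text \<open>Inside the Laurent ring of \<open>x\<close>, localizing at \<open>c\<close> adds nothing
  to the exchanged ring when \<open>c\<close> at x_j = 0 is coprime to \<open>Q\<close>: the power
  of \<open>c\<close> cancels in the adic criterion.\<close>

lemma saturation_exchanged_laurent:
  fixes emb :: "'a::{factorial_semiring, idom} \<Rightarrow> 'k::field"
  assumes emb: "ring_hom emb" and x: "alg_indep emb n x" and "j < n"
    and Q: "Q \<in> mpolys ({..<n} - {j})" "Q \<noteq> 0" "\<And>l. \<not> Var l dvd Q"
    and c: "c \<in> mpolys {..<n}" "\<And>m z. Q ^ m dvd cf j c 0 * z \<Longrightarrow> Q ^ m dvd z"
    and y: "y \<in> laurent emb {..<n} x"
      "y \<in> saturation (laurent emb {..<n} (x(j := meval emb x Q / x j))) (meval emb x c)"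
  shows "y \<in> laurent emb {..<n} (x(j := meval emb x Q / x j))"
proof -
  note hom = ring_homD[OF ring_hom_meval[OF emb]]
  obtain f L e where f: "f \<in> mpolys {..<n}"
    and yf: "y = meval emb x f / x j ^ L * (\<Prod>l\<in>{..<n} - {j}. inverse (x l) ^ e l)"
    using laurent_split_denominator[OF y(1) \<open>j < n\<close>] by metis
  let ?B = "laurent emb {..<n} (x(j := meval emb x Q / x j))"
  let ?mon = "\<Prod>l\<in>{..<n} - {j}. x l ^ e l"
  have nz: "x l \<noteq> 0" if "l < n" for l
    using alg_indep_var_nonzero[OF emb x that] .
  note gens = exchanged_laurent_generators[OF emb x \<open>j < n\<close> Q(1,2)]
  note B = gens(1)
  obtain M where M: "meval emb x c ^ M * y \<in> ?B"
    using y(2) by (auto simp: saturation_def)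
  have "(\<Prod>l\<in>{..<n} - {j}. inverse (x l) ^ e l) * ?mon = 1"
    unfolding prod.distrib[symmetric] using nz by (intro prod.neutral) (auto simp flip: power_mult_distrib)
  then have "meval emb x (c ^ M * f) / x j ^ L = meval emb x c ^ M * y * ?mon"
    by (simp add: yf mult.assoc hom)
  moreover have "?mon \<in> ?B"
    by (intro is_subring_prod[OF B] is_subringD[OF B] gens) auto
  ultimately have "meval emb x (c ^ M * f) / x j ^ L \<in> ?B"
    using M is_subringD[OF B] by simp
  then have "adic j Q L (c ^ M * f)"
    using c f by (intro in_exchanged_laurent_imp_adic[OF emb x \<open>j < n\<close> Q]) (simp_all add: mpolys_closed)
  then have "adic j Q L f"
    by (rule adic_power_mult_cancel[rotated]) (rule c(2))
  then have "meval emb x f / x j ^ L \<in> ?B"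
    by (intro adic_imp_in_subring[OF emb B laurent_const[OF emb] _ gens(4) _ f])
       (use gens(2) nz \<open>j < n\<close> in auto)
  then show ?thesis
    unfolding yf by (intro is_subringD[OF B] is_subring_prod[OF B] gens(3)) auto
qed

text \<open>Follows from the factorization of \<open>s ^ i - t ^ i\<close> for each power of the
  variable \<open>k\<close>.\<close>

lemma meval_diff_in_subring:
  fixes emb :: "'a::comm_ring_1 \<Rightarrow> 'k::field"
  assumes emb: "ring_hom emb" and T: "is_subring T" "\<And>c. emb c \<in> T"
    and v: "\<And>l. l \<in> vars p \<Longrightarrow> l \<noteq> k \<Longrightarrow> v l \<in> T" and st: "s \<in> T" "t \<in> T"
  shows "\<exists>r\<in>T. meval emb (v(k := s)) p - meval emb (v(k := t)) p = (s - t) * r"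
proof -
  let ?r = "\<lambda>i. \<Sum>m<i. t ^ (i - Suc m) * s ^ m"
  have "meval emb (v(k := s)) p - meval emb (v(k := t)) p =
      (s - t) * (\<Sum>i\<le>degree (as_poly k p). meval emb v (cf k p i) * ?r i)"
    unfolding meval_upd_eq_sum_cf[OF emb] sum_distrib_left[of "s - t"] sum_subtractf[symmetric]
  proof (rule sum.cong)
    fix i
    show "meval emb v (cf k p i) * s ^ i - meval emb v (cf k p i) * t ^ i =
        (s - t) * (meval emb v (cf k p i) * ?r i)"
      using power_diff_sumr2[of s i t]
      by (simp only: right_diff_distrib[symmetric] mult.left_commute)
  qed simp
  moreover have "meval emb v (cf k p i) \<in> T" for i
    using cf_in_mpolys[of p "vars p" k i] v
    by (intro meval_in_subring[OF T]) (auto simp: mpolys_def)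
  then have "(\<Sum>i\<le>degree (as_poly k p). meval emb v (cf k p i) * ?r i) \<in> T"
    by (intro is_subring_sum[OF T(1)] is_subringD[OF T(1)] st)
  ultimately show ?thesis by blast
qed

section \<open>Trivial denominators and irreducibility inside subrings\<close>

lemma meval_at_zero:
  assumes "ring_hom h"
  shows "meval h (x(j := 0)) p = meval h x (cf j p 0)"
  unfolding meval_upd_eq_sum_cf[OF assms]
  by (subst sum.remove[of _ 0]) (auto intro!: sum.neutral simp: power_0_left)

text \<open>Substituting a multiple of \<open>F j\<close> for x_j leaves \<open>F k\<close>
  congruent, modulo \<open>F j\<close>, to its value at x_j = 0. If \<open>F j\<close> divided that
  value, the exponent 1 would be admissible in \<open>hat_exp\<close>.\<close>

lemma hat_exp_eq_0_imp_not_dvd: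
  fixes F :: "nat \<Rightarrow> 'a::{factorial_semiring, idom} mpoly"
  assumes "hat_exp F k j = 0" "irreducible (F j)" "\<not> Var j dvd F k"
  shows "\<not> F j dvd cf j (F k) 0"
proof
  assume dvd: "F j dvd cf j (F k) 0"
  define \<sigma> :: "nat \<Rightarrow> 'a mpoly" where "\<sigma> = (\<lambda>l. if l = j then F j * Var j else Var l)"
  define q where "q = meval Const \<sigma> (F k)"
  have \<sigma>: "\<sigma> = Var(j := F j * Var j)"
    by (auto simp: \<sigma>_def)
  have "q = (\<Sum>i\<le>degree (as_poly j (F k)). cf j (F k) i * (F j * Var j) ^ i)"
    unfolding q_def \<sigma> meval_upd_eq_sum_cf[OF ring_hom_Const] by (simp add: meval_Const_Var)
  also have "\<dots> = cf j (F k) 0 + (\<Sum>i\<in>{..degree (as_poly j (F k))} - {0}. cf j (F k) i * (F j * Var j) ^ i)"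
    by (subst sum.remove[of _ 0]) auto
  finally have q: "q = \<dots>" .
  have rest: "F j * Var j dvd (\<Sum>i\<in>{..degree (as_poly j (F k))} - {0}. cf j (F k) i * (F j * Var j) ^ i)"
    by (intro dvd_sum dvd_mult dvd_power) auto
  \<comment> \<open>Only for a nonzero \<open>q\<close> does the \<open>GREATEST\<close> range over
    a bounded set of exponents.\<close>
  have "q \<noteq> 0"
  proof
    assume "q = 0"
    then have "cf j (F k) 0 = - (\<Sum>i\<in>{..degree (as_poly j (F k))} - {0}. cf j (F k) i * (F j * Var j) ^ i)"
      using q by (simp add: eq_neg_iff_add_eq_0)
    then have "Var j dvd cf j (F k) 0"
      using dvd_mult_right[OF rest] by simp
    then have "cf j (cf j (F k) 0) 0 = 0"
      by (simp add: Var_dvd_iff)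
    moreover have "j \<notin> vars (cf j (F k) 0)"
      using cf_in_mpolys[of "F k" UNIV j 0] by (auto simp: mpolys_def)
    ultimately have "cf j (F k) 0 = 0"
      by (simp add: as_poly_not_in_vars)
    then show False
      using assms(3) by (simp add: Var_dvd_iff)
  qed
  moreover have "\<not> F j dvd 1"
    using assms(2) by (auto simp: irreducible_def)
  ultimately obtain b where "\<forall>m. F j ^ m dvd q \<longrightarrow> m \<le> b"
    using power_dvd_bounded by blast
  moreover have "F j ^ 1 dvd q"
    unfolding q using dvd dvd_mult_left[OF rest] by simp
  ultimately have "1 \<le> (GREATEST m. F j ^ m dvd q)"
    by (intro Greatest_le_nat[where b = b]) auto
  then show False
    using assms(1) by (simp add: hat_exp_def q_def \<sigma>_def)
qed

text \<open>Transfers irreducibility to the subring of the field in which \<open>mut_poly\<close>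
  expresses its conditions: evaluation is injective, and inverses of units stay within the variables
  \<open>W\<close>.\<close>

lemma sirred_meval:
  fixes emb :: "'a::idom \<Rightarrow> 'k::field"
  assumes emb: "ring_hom emb" and x: "alg_indep emb n x" and W: "W \<subseteq> {..<n}"
    and q: "q \<in> mpolys W" "irreducible q"
  shows "sirred (polyring emb W x) (meval emb x q)"
  unfolding sirred_def
proof (intro conjI ballI impI)
  note hom = ring_homD[OF ring_hom_meval[OF emb]]
  have inj: "p = p'" if "p \<in> mpolys W" "p' \<in> mpolys W" "meval emb x p = meval emb x p'" for p p'
    using alg_indep_inject[OF emb x] mpolys_mono[OF W] that by blast
  have unit: "sunit (polyring emb W x) (meval emb x u) \<longleftrightarrow> u dvd 1" if u: "u \<in> mpolys W" for u
  proof
    assume "sunit (polyring emb W x) (meval emb x u)"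
    then obtain c where c: "c \<in> mpolys W" "1 = meval emb x u * meval emb x c"
      by (auto simp: sunit_def sdvd_def polyring_eq_image)
    then have "u * c = 1"
      using u by (intro inj) (auto simp: hom mpolys_closed)
    then show "u dvd 1" by (metis dvd_triv_left)
  next
    assume "u dvd 1"
    then obtain w where w: "1 = u * w" by (rule dvdE)
    then have "w \<in> mpolys W"
      using factors_in_mpolys(2)[of u w W] by (simp add: mpolys_closed flip: w)
    moreover have "1 = meval emb x u * meval emb x w"
      by (simp add: hom flip: w hom(4))
    ultimately show "sunit (polyring emb W x) (meval emb x u)"
      using u by (auto simp: sunit_def sdvd_def polyring_eq_image)
  qed
  show "meval emb x q \<in> polyring emb W x"
    using q by (simp add: polyring_eq_image)
  show "meval emb x q \<noteq> 0"
    using alg_indep_nonzero[OF emb x mpolys_mono[OF W q(1)]] q(2) by (auto simp: irreducible_def)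
  show "\<not> sunit (polyring emb W x) (meval emb x q)"
    using unit[OF q(1)] q(2) by (auto simp: irreducible_def)
  fix a b assume "a \<in> polyring emb W x" "b \<in> polyring emb W x" "meval emb x q = a * b"
  then obtain a' b' where ab: "a = meval emb x a'" "b = meval emb x b'" "a' \<in> mpolys W" "b' \<in> mpolys W"
    "meval emb x q = meval emb x (a' * b')"
    by (auto simp: polyring_eq_image hom)
  then have "q = a' * b'"
    by (intro inj q) (auto simp: mpolys_closed)
  then show "sunit (polyring emb W x) a \<or> sunit (polyring emb W x) b"
    using irreducibleD[OF q(2)] unit ab by blast
qed

section \<open>Mutation of the exchange polynomials\<close>

lemma laurent_Diff_subset_exchanged:
  fixes emb :: "'a::idom \<Rightarrow> 'k::field"
  assumes emb: "ring_hom emb" and x: "alg_indep emb n x" and "j < n"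
    and Q: "Q \<in> mpolys ({..<n} - {j})" "Q \<noteq> 0"
  shows "laurent emb ({..<n} - {j}) x \<subseteq> laurent emb {..<n} (x(j := meval emb x Q / x j))"
  using exchanged_laurent_generators[OF assms]
  by (intro laurent_subset laurent_const[OF emb]) auto

text \<open>Modulo x_j the exchange relation says that x_k is \<open>P\<close> at x_j = 0 divided by
  \<open>a'\<close>, so substituting this for x_k changes \<open>Q\<close> only by a multiple of
  x_j.\<close>

lemma exchange_congruence:
  fixes emb :: "'a::idom \<Rightarrow> 'k::field"
  assumes emb: "ring_hom emb" and "x j \<noteq> 0" "x k \<noteq> 0" "j < n" "k < n" "meval emb x P \<noteq> 0"
    and P: "P \<in> mpolys {..<n}" and Q: "Q \<in> mpolys {..<n}"
    and a': "a' = meval emb x P / x k"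
    and T: "is_subring T" "\<And>c. emb c \<in> T" "\<And>l. l < n \<Longrightarrow> x l \<in> T" "inverse a' \<in> T"
  shows "(meval emb x Q - meval emb (x(k := meval emb x (cf j P 0) / a')) Q) / x j \<in> T"
proof -
  note closed = is_subringD[OF T(1)]
  have "cf j P 0 \<in> mpolys {..<n}"
    using cf_in_mpolys[OF P, of j 0] by (auto simp: mpolys_def)
  then have "meval emb x (cf j P 0) \<in> T"
    by (intro meval_in_subring[OF T(1,2)] T(3)) (auto simp: mpolys_def)
  then have N: "meval emb x (cf j P 0) / a' \<in> T"
    using closed(6) T(4) by (simp add: divide_inverse)
  have "\<exists>r\<in>T. meval emb (x(j := x j)) P - meval emb (x(j := 0)) P = (x j - 0) * r"
    by (rule meval_diff_in_subring[OF emb T(1,2)])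
       (use P T(3) \<open>j < n\<close> closed in \<open>auto simp: mpolys_def\<close>)
  then obtain r where r: "r \<in> T" "meval emb x P - meval emb x (cf j P 0) = x j * r"
    by (auto simp: meval_at_zero[OF emb])
  have "\<exists>s\<in>T. meval emb (x(k := x k)) Q - meval emb (x(k := meval emb x (cf j P 0) / a')) Q =
      (x k - meval emb x (cf j P 0) / a') * s"
    by (rule meval_diff_in_subring[OF emb T(1,2)])
       (use Q T(3) \<open>k < n\<close> N in \<open>auto simp: mpolys_def\<close>)
  then obtain s where s: "s \<in> T"
    "meval emb x Q - meval emb (x(k := meval emb x (cf j P 0) / a')) Q =
      (x k - meval emb x (cf j P 0) / a') * s"
    by auto
  \<comment> \<open>Here x_k is written as \<open>P\<close> over \<open>a'\<close>; the difference
    then becomes x_j times \<open>r\<close> over \<open>a'\<close>.\<close>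
  have "x k - meval emb x (cf j P 0) / a' = (meval emb x P - meval emb x (cf j P 0)) / a'"
    using assms(3,6) by (simp add: a' field_simps)
  then have "(meval emb x Q - meval emb (x(k := meval emb x (cf j P 0) / a')) Q) / x j =
      r * inverse a' * s"
    unfolding s(2) r(2) using assms(2) by (simp add: divide_inverse)
  then show ?thesis
    using closed(6) r s T(4) by simp
qed

text \<open>Each inclusion is checked on generators in a localization of the target ring, and
  coprimality then leads back to that ring. Besides a removed factor \<open>D\<close> and a unit
  \<open>w\<close> coming from a mutation, the hypotheses admit \<open>D\<close> and
  \<open>w\<close> equal to 1, which handles a \<open>Q\<close> without x_k.\<close>

lemma exchanged_laurent_mutation:
  fixes emb :: "'a::{factorial_semiring, idom} \<Rightarrow> 'k::field"
  assumes emb: "ring_hom emb" and x: "alg_indep emb n x" and jk: "j < n" "k < n" "j \<noteq> k"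
    and P: "P \<in> mpolys ({..<n} - {k})" "P \<noteq> 0"
    and x': "x' = x(k := meval emb x P / x k)"
    and Q: "Q \<in> mpolys ({..<n} - {j})" "Q \<noteq> 0" "\<And>l. \<not> Var l dvd Q"
    and Q': "Q' \<in> mpolys ({..<n} - {j})" "Q' \<noteq> 0" "\<And>l. \<not> Var l dvd Q'"
    and D: "D \<in> mpolys ({..<n} - {j, k})" "D \<noteq> 0"
    and coprime: "\<And>m z. Q ^ m dvd cf j P 0 * D * z \<Longrightarrow> Q ^ m dvd z"
    and coprime': "\<And>m z. Q' ^ m dvd cf j P 0 * z \<Longrightarrow> Q' ^ m dvd z"
    and w: "w \<in> laurent emb ({..<n} - {j}) x'" "inverse w \<in> laurent emb ({..<n} - {j}) x'" "w \<noteq> 0"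
    and eq: "meval emb x' Q' * meval emb x D = w * meval emb (x(k := meval emb x (cf j P 0) / x' k)) Q"
    and y: "y \<in> laurent emb {..<n} x" "y \<in> laurent emb {..<n} x'"
  shows "y \<in> laurent emb {..<n} (x(j := meval emb x Q / x j)) \<longleftrightarrow>
         y \<in> laurent emb {..<n} (x'(j := meval emb x' Q' / x' j))"
proof -
  note hom = ring_homD[OF ring_hom_meval[OF emb]]
  have ai': "alg_indep emb n x'"
    unfolding x' by (rule alg_indep_exchange[OF emb x jk(2) P])
  have nz: "x l \<noteq> 0" "x' l \<noteq> 0" if "l < n" for l
    using alg_indep_var_nonzero[OF emb x that] alg_indep_var_nonzero[OF emb ai' that] .
  have Pn: "P \<in> mpolys {..<n}" and Qn: "Q \<in> mpolys {..<n}" and Dn: "D \<in> mpolys {..<n}"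
    using P Q D by (auto simp: mpolys_def)
  have P0: "meval emb x P \<noteq> 0" and D0: "meval emb x D \<noteq> 0"
    using alg_indep_nonzero[OF emb x] Pn P Dn D by blast+
  have P': "meval emb x' P = meval emb x P" and D': "meval emb x' D = meval emb x D"
    unfolding x' by (rule meval_upd_not_in_vars; use P D in \<open>auto simp: mpolys_def\<close>)+
  have x'_eq: "x' j = x j" "x' l = x l" if "l \<noteq> k" for l
    using that jk by (auto simp: x')
  have x'k: "x' k = meval emb x P / x k" by (simp add: x')
  let ?B = "laurent emb {..<n} (x(j := meval emb x Q / x j))"
  let ?B' = "laurent emb {..<n} (x'(j := meval emb x' Q' / x' j))"
  let ?G = "meval emb (x(k := meval emb x (cf j P 0) / x' k)) Q"
  note gens = exchanged_laurent_generators[OF emb x jk(1) Q(1,2)]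
  note gens' = exchanged_laurent_generators[OF emb ai' jk(1) Q'(1,2)]
  have const: "emb c \<in> ?B" "emb c \<in> ?B'" for c
    by (rule laurent_const[OF emb])+
  have poly: "meval emb x p \<in> ?B" "meval emb x' p \<in> ?B'" if "p \<in> mpolys {..<n}" for p
    using that gens gens' const
    by (auto intro!: meval_in_subring[OF gens(1)] meval_in_subring[OF gens'(1)] simp: mpolys_def)
  show ?thesis
  proof
    assume y_B: "y \<in> ?B"
    \<comment> \<open>Over the mutated cluster x_k is \<open>P\<close> over the new variable, so the
      inverse of x_k requires \<open>P\<close> to be inverted.\<close>
    define T where "T = saturation ?B' (meval emb x' P)"
    have T: "is_subring T"
      unfolding T_def by (rule is_subring_saturation[OF gens'(1) poly(2)[OF Pn]])
    have sub: "?B' \<subseteq> T"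
      by (auto simp: T_def intro: subset_saturation)
    have x_k: "x k = meval emb x' P * inverse (x' k)"
      using nz[OF jk(2)] P0 by (simp add: P' x'k)
    have xT: "x l \<in> T" if "l < n" for l
    proof (cases "l = k")
      case True
      then show ?thesis
        unfolding True x_k using poly(2)[OF Pn] gens'(3)[of k] jk is_subringD(6)[OF gens'(1)] sub by blast
    next
      case False
      then show ?thesis
        using x'_eq(2)[OF False] gens'(2)[OF that] sub by auto
    qed
    have xT_inv: "inverse (x l) \<in> T" if "l < n" "l \<noteq> j" for l
    proof (cases "l = k")
      case True
      have "meval emb x' P * inverse (x k) = x' k"
        by (simp add: P' x'k divide_inverse)
      then show ?thesis
        unfolding True T_def using gens'(2)[OF jk(2)] by (auto intro: saturationI)
    next
      case False
      then show ?thesis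
        using x'_eq(2)[OF False] gens'(3)[OF that] sub by auto
    qed
    \<comment> \<open>Up to the unit \<open>w\<close> the substituted \<open>Q\<close> is
      \<open>Q'\<close> times \<open>D\<close>, and \<open>Q'\<close> over x_j is a generator of the
      target ring.\<close>
    have "?G / x j = inverse w * (meval emb x' Q' / x' j) * meval emb x' D"
      using eq w(3) jk by (simp add: D' x'_eq field_simps)
    also have "\<dots> \<in> T"
      using w laurent_Diff_subset_exchanged[OF emb ai' jk(1) Q'(1,2)] gens'(4) poly(2)[OF Dn] sub
      by (intro is_subringD[OF T]) blast+
    finally have "?G / x j \<in> T" .
    moreover have "(meval emb x Q - ?G) / x j \<in> T"
      using gens'(3)[of k] jk nz sub xT P0 const
      by (intro exchange_congruence[OF emb _ _ jk(1,2) _ Pn Qn x'k T]) auto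
    ultimately have "meval emb x Q / x j \<in> T"
      using is_subringD(3)[OF T] by (metis diff_add_cancel add_divide_distrib)
    then have "y \<in> T"
      using const sub xT xT_inv
      by (intro in_exchanged_laurent_imp_in_subring[OF emb x jk(1) Q y(1) y_B T]) auto
    then show "y \<in> ?B'"
      unfolding T_def using coprime'
      by (intro saturation_exchanged_laurent[OF emb ai' jk(1) Q' Pn _ y(2)])
  next
    assume y_B': "y \<in> ?B'"
    \<comment> \<open>\<open>P\<close> is inverted to obtain the inverse of the new variable, and
      \<open>D\<close> because \<open>Q'\<close> arises from the substituted \<open>Q\<close> by
      division by \<open>D\<close>.\<close>
    define T where "T = saturation ?B (meval emb x (P * D))"
    have T: "is_subring T"
      unfolding T_def by (rule is_subring_saturation[OF gens(1) poly(1)]) (simp add: Pn Dn mpolys_closed)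
    have sub: "?B \<subseteq> T"
      by (auto simp: T_def intro: subset_saturation)
    have xT: "x' l \<in> T" if "l < n" for l
    proof (cases "l = k")
      case True
      then show ?thesis
        unfolding True x'k divide_inverse
        using poly(1)[OF Pn] gens(3)[of k] jk is_subringD(6)[OF gens(1)] sub by blast
    next
      case False
      then show ?thesis
        using x'_eq(2)[OF False] gens(2)[OF that] sub by auto
    qed
    have xT_inv: "inverse (x' l) \<in> T" if "l < n" "l \<noteq> j" for l
    proof (cases "l = k")
      case True
      have "meval emb x (P * D) * inverse (x' k) = x k * meval emb x D"
        using P0 by (simp add: hom x'k)
      then show ?thesis
        unfolding True T_def using gens(2)[OF jk(2)] poly(1)[OF Dn] is_subringD(6)[OF gens(1)]
        by (auto intro!: saturationI)
    next
      case False
      then show ?thesis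
        using x'_eq(2)[OF False] gens(3)[OF that] sub by auto
    qed
    have "meval emb x (P * D) * inverse (meval emb x D) = meval emb x P"
      using D0 by (simp add: hom)
    then have D_inv: "inverse (meval emb x D) \<in> T"
      unfolding T_def using poly(1)[OF Pn] by (auto intro!: saturationI)
    have "laurent emb ({..<n} - {j}) x' \<subseteq> T"
      by (intro laurent_subset[OF T]) (use const sub xT xT_inv in auto)
    then have "w \<in> T" using w by blast
    have "(meval emb x Q - ?G) / x j \<in> T"
      using gens(2) xT_inv[of k] jk nz sub P0 const
      by (intro exchange_congruence[OF emb _ _ jk(1,2) _ Pn Qn x'k T]) auto
    moreover have "meval emb x Q / x j \<in> T"
      using gens(4) sub by blast
    ultimately have "meval emb x Q / x j - (meval emb x Q - ?G) / x j \<in> T"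
      using is_subringD(5)[OF T] by blast
    then have G: "?G / x j \<in> T"
      by (simp add: diff_divide_distrib)
    have "meval emb x' Q' / x' j = w * (?G / x j) * inverse (meval emb x D)"
      using eq D0 jk nz(1)[OF jk(1)] by (simp add: x'_eq field_simps)
    also have "\<dots> \<in> T"
      by (intro is_subringD[OF T] \<open>w \<in> T\<close> G D_inv)
    finally have y_T: "y \<in> T"
      using const sub xT xT_inv
      by (intro in_exchanged_laurent_imp_in_subring[OF emb ai' jk(1) Q' y(2) y_B' T]) auto
    \<comment> \<open>As \<open>D\<close> is free of x_j, setting x_j to 0 in \<open>P * D\<close>
      gives the product that occurs in \<open>coprime\<close>.\<close>
    have "j \<notin> vars D"
      using D(1) by (auto simp: mpolys_def)
    then have cf_PD: "cf j (P * D) 0 = cf j P 0 * D"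
      by (simp add: as_poly_simps coeff_mult as_poly_not_in_vars)
    have PD: "P * D \<in> mpolys {..<n}"
      using Pn Dn by (rule mpolys_closed)
    show "y \<in> ?B"
    proof (rule saturation_exchanged_laurent[OF emb x jk(1) Q PD _ y(1) y_T[unfolded T_def]])
      fix m z assume "Q ^ m dvd cf j (P * D) 0 * z"
      then show "Q ^ m dvd z"
        unfolding cf_PD by (rule coprime)
    qed
  qed
qed

section \<open>Data supplied by a mutation\<close>

lemma monomial_eq_1_imp:
  assumes "(\<Prod>l\<in>S. Var l ^ e l) = (1 :: 'a::idom mpoly)" "finite S" "l \<in> S"
  shows "e l = 0"
proof (rule ccontr)
  assume "e l \<noteq> 0"
  then have "Var l dvd (Var l ^ e l :: 'a mpoly)"
    by (intro dvd_power) auto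
  also have "\<dots> dvd (\<Prod>l\<in>S. Var l ^ e l)"
    using assms by (intro dvd_prodI) auto
  finally show False
    using prime_elem_Var[of l, where ?'a = 'a] assms(1) by (auto simp: prime_elem_def)
qed

text \<open>An irreducible common factor of \<open>Q\<close> and \<open>c\<close> would be an
  associate of \<open>Q\<close>, which would then divide \<open>c\<close>.\<close>

lemma irreducible_power_dvd_cancel:
  fixes Q c :: "'a::{factorial_semiring, idom} mpoly"
  assumes "irreducible Q" "\<not> Q dvd c" "Q ^ m dvd c * z"
  shows "Q ^ m dvd z"
proof (rule power_dvd_mult_cancel[OF _ _ assms(3)])
  show "c \<noteq> 0" using assms(2) by auto
  fix q assume q: "irreducible q" "q dvd c"
  show "\<not> q dvd Q"
  proof
    assume "q dvd Q"
    then obtain t where t: "Q = q * t" by (rule dvdE)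
    moreover have "\<not> q dvd 1"
      using q by (auto simp: irreducible_def)
    ultimately have "t dvd 1"
      using irreducibleD[OF assms(1) t] by blast
    then have "Q dvd q"
      using mult_dvd_mono[of q q t 1] by (simp add: t)
    then show False
      using q assms(2) dvd_trans by blast
  qed
qed

lemma emb_unit:
  fixes emb :: "'a::comm_ring_1 \<Rightarrow> 'k::field"
  assumes "ring_hom emb" "u dvd 1"
  obtains v where "inverse (emb u) = emb v" "emb u \<noteq> 0"
proof -
  obtain v where "1 = u * v"
    using assms(2) by (rule dvdE)
  then have "emb u * emb v = 1"
    using ring_homD[OF assms(1)] by metis
  then show ?thesis
    using that[of v] by (metis inverse_unique mult_zero_left zero_neq_one)
qed

text \<open>Turns the conditions of \<open>mut_poly\<close>, stated for elements of the field, into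
  polynomials and coprimality. That \<open>Q'\<close> is free of x_j has to be derived.\<close>

lemma mut_polyE:
  fixes emb :: "'a::{factorial_semiring, idom} \<Rightarrow> 'k::field"
  assumes emb: "ring_hom emb" and x: "alg_indep emb n x" and jk: "j < n" "k < n" "j \<noteq> k"
    and P: "F k \<in> mpolys ({..<n} - {k})" "F k \<noteq> 0" "\<not> Var j dvd F k"
    and hat: "\<And>l. l < n \<Longrightarrow> l \<noteq> k \<Longrightarrow> hat_exp F k l = 0"
    and x': "x' = x(k := meval emb x (F k) / x k)"
    and Q: "F j \<in> mpolys ({..<n} - {j})"
    and mut: "mut_poly emb n k j x F x' Q'"
  obtains D w where "D \<in> mpolys ({..<n} - {j, k})" "D \<noteq> 0"
    "w \<in> laurent emb ({..<n} - {j}) x'" "inverse w \<in> laurent emb ({..<n} - {j}) x'" "w \<noteq> 0"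
    "meval emb x' Q' * meval emb x D = w * meval emb (x(k := meval emb x (cf j (F k) 0) / x' k)) (F j)"
    "Q' \<in> mpolys ({..<n} - {j})" "Q' \<noteq> 0" "\<And>l. \<not> Var l dvd Q'"
    "\<And>m z. Q' ^ m dvd cf j (F k) 0 * z \<Longrightarrow> Q' ^ m dvd z"
proof -
  note hom = ring_homD[OF ring_hom_meval[OF emb]]
  let ?W = "{..<n} - {j, k}" and ?C = "laurent emb ({..<n} - {j}) x'" and ?p = "cf j (F k) 0"
  let ?G = "meval emb (x(k := meval emb x ?p / x' k)) (F j)"
  have ai': "alg_indep emb n x'"
    unfolding x' by (rule alg_indep_exchange[OF emb x jk(2) P(1,2)])
  have nz: "x' l \<noteq> 0" if "l < n" for l
    using alg_indep_var_nonzero[OF emb ai' that] .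
  \<comment> \<open>By \<open>hat\<close> the denominator of the exchange Laurent polynomial at x_j
    = 0 is 1.\<close>
  have "(\<Prod>l\<in>?W. x l ^ hat_exp F k l) = 1"
    using hat by (intro prod.neutral) auto
  with mut obtain D0 u e where
    Q'n: "vars Q' \<subseteq> {..<n}" and Var: "\<And>l. \<not> Var l dvd Q'" and
    D0: "D0 \<in> polyring emb ?W x" "D0 \<noteq> 0" and u: "u dvd 1" and
    eq: "meval emb x' Q' * D0 = emb u * (\<Prod>l\<in>{..<n} - {j}. x' l powi e l) * ?G" and
    irr: "\<And>q. sirred (polyring emb ?W x) q \<Longrightarrow> sdvd (polyring emb ?W x) q (meval emb x ?p) \<Longrightarrow>
      \<not> sdvd (polyring emb {..<n} x') q (meval emb x' Q')"
    unfolding mut_poly_def Let_def meval_at_zero[OF emb] by auto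
  obtain D where D: "D \<in> mpolys ?W" "D0 = meval emb x D"
    using D0 by (auto simp: polyring_eq_image)
  then have "D \<noteq> 0"
    using D0 by (auto simp: hom)
  define w where "w = emb u * (\<Prod>l\<in>{..<n} - {j}. x' l powi e l)"
  have C: "is_subring ?C"
    by (rule is_subring_laurent[OF emb]) (use nz in auto)
  note closed = is_subringD[OF C]
  have gen: "x' l \<in> ?C" "inverse (x' l) \<in> ?C" if "l < n" "l \<noteq> j" for l
    using laurent_var[OF emb, of l "{..<n} - {j}" x']
      laurent_var_inverse[OF emb, of "{..<n} - {j}" l x'] that by auto
  obtain v where v: "inverse (emb u) = emb v" "emb u \<noteq> 0"
    using emb_unit[OF emb u] by blast
  have "w \<in> ?C"
    unfolding w_def
    by (intro closed(6) is_subring_prod[OF C] power_int_in_subring[OF C] laurent_const[OF emb] gen) auto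
  have "inverse w = emb v * (\<Prod>l\<in>{..<n} - {j}. x' l powi (- e l))"
    by (simp add: w_def v power_int_minus prod_inversef[symmetric] comp_def)
  also have "\<dots> \<in> ?C"
    by (intro closed(6) is_subring_prod[OF C] power_int_in_subring[OF C] laurent_const[OF emb] gen) auto
  finally have "inverse w \<in> ?C" .
  have "w \<noteq> 0"
    using v nz by (auto simp: w_def)
  \<comment> \<open>The zero polynomial would be divisible by every variable.\<close>
  have "Q' \<noteq> 0"
    using Var[of 0] by auto
  have p: "?p \<in> mpolys ?W"
    using cf_in_mpolys[OF P(1), of j 0] by (simp add: Diff_insert2[symmetric] insert_commute)
  have x'_eq: "meval emb x' q = meval emb x q" if "q \<in> mpolys ?W" for q
    unfolding x' by (rule meval_upd_not_in_vars) (use that in \<open>auto simp: mpolys_def\<close>)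
  \<comment> \<open>The right-hand side of the mutation identity lies in the Laurent ring without
    x_j. Clearing denominators exhibits \<open>Q'\<close> as a factor of a nonzero polynomial free
    of x_j.\<close>
  have "meval emb x ?p \<in> ?C"
    unfolding x'_eq[OF p, symmetric]
    by (rule meval_in_subring[OF C laurent_const[OF emb]]) (use p gen in \<open>auto simp: mpolys_def\<close>)
  then have "meval emb x ?p / x' k \<in> ?C"
    using closed(6) gen[of k] jk by (simp add: divide_inverse)
  moreover have "x l \<in> ?C" if "l < n" "l \<noteq> j" "l \<noteq> k" for l
    using gen[of l] that by (simp add: x')
  ultimately have "?G \<in> ?C"
    by (intro meval_in_subring[OF C laurent_const[OF emb]]) (use Q in \<open>auto simp: mpolys_def\<close>)
  then have "meval emb x' Q' * D0 \<in> ?C"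
    unfolding eq using \<open>w \<in> ?C\<close> closed(6) by (simp add: w_def)
  then obtain g f where g: "g \<in> mpolys ({..<n} - {j})"
    "meval emb x' Q' * D0 = meval emb x' g / (\<Prod>l\<in>{..<n} - {j}. x' l ^ f l)"
    by (auto simp: laurent_def mpolys_def)
  let ?mon = "\<Prod>l\<in>{..<n} - {j}. Var l ^ f l :: 'a mpoly"
  have "meval emb x' (Q' * (D * ?mon)) = meval emb x' g"
    using g(2) nz by (simp add: hom meval_monomial[OF emb] D x'_eq field_simps)
  moreover have "Q' \<in> mpolys {..<n}" "D \<in> mpolys {..<n}" "g \<in> mpolys {..<n}"
    using D Q'n g(1) by (auto simp: mpolys_def)
  ultimately have "Q' * (D * ?mon) = g"
    by (intro alg_indep_inject[OF emb ai']) (auto intro!: mpolys_closed monomial_in_mpolys)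
  moreover from this have "g \<noteq> 0"
    using \<open>Q' \<noteq> 0\<close> \<open>D \<noteq> 0\<close> by (auto simp: Var_neq_0)
  ultimately have "Q' \<in> mpolys ({..<n} - {j})"
    using factors_in_mpolys(1)[of Q' "D * ?mon"] g(1) by simp
  \<comment> \<open>A common irreducible factor would, after evaluation, contradict the last
    condition of \<open>mut_poly\<close>.\<close>
  have "Q' ^ m dvd z" if "Q' ^ m dvd ?p * z" for m z
  proof (rule power_dvd_mult_cancel[OF _ _ that])
    show "?p \<noteq> 0" using P(3) by (simp add: Var_dvd_iff)
    fix q assume q: "irreducible q" "q dvd ?p"
    then obtain t where t: "?p = q * t" by (auto elim: dvdE)
    have W: "q \<in> mpolys ?W" "t \<in> mpolys ?W"
      using factors_in_mpolys[of q t ?W] p t \<open>?p \<noteq> 0\<close> by auto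
    show "\<not> q dvd Q'"
    proof
      assume "q dvd Q'"
      then obtain s where s: "Q' = q * s" by (auto elim: dvdE)
      have "s \<in> mpolys {..<n}"
        using factors_in_mpolys(2)[of q s] s Q'n \<open>Q' \<noteq> 0\<close> by (simp add: mpolys_def)
      then have "sdvd (polyring emb {..<n} x') (meval emb x q) (meval emb x' Q')"
        by (auto simp: sdvd_def s hom x'_eq[OF W(1)] polyring_eq_image)
      moreover have "sdvd (polyring emb ?W x) (meval emb x q) (meval emb x ?p)"
        using W by (auto simp: sdvd_def t hom polyring_eq_image)
      moreover have "sirred (polyring emb ?W x) (meval emb x q)"
        by (rule sirred_meval[OF emb x _ W(1) q(1)]) auto
      ultimately show False
        using irr by blast
    qed
  qed
  moreover have "meval emb x' Q' * meval emb x D = w * ?G"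
    using eq by (simp add: D w_def)
  ultimately show ?thesis
    using that D(1) \<open>D \<noteq> 0\<close> \<open>w \<in> ?C\<close> \<open>inverse w \<in> ?C\<close> \<open>w \<noteq> 0\<close> \<open>Q' \<in> mpolys ({..<n} - {j})\<close>
      \<open>Q' \<noteq> 0\<close> Var by blast
qed

text \<open>The denominator of \<open>hatF\<close> is a monomial in the other variables, hence a
  unit of their Laurent ring.\<close>

lemma laurent_hatF:
  fixes emb :: "'a::idom \<Rightarrow> 'k::field"
  assumes emb: "ring_hom emb" and x: "alg_indep emb n x" and "j < n" and nz: "meval emb x (F j) \<noteq> 0"
  shows "laurent emb {..<n} (x(j := hatF emb n x F j / x j)) =
    laurent emb {..<n} (x(j := meval emb x (F j) / x j))"
proof -
  let ?C = "laurent emb ({..<n} - {j}) x"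
  define w where "w = inverse (\<Prod>l\<in>{..<n} - {j}. x l ^ hat_exp F j l)"
  have x0: "x l \<noteq> 0" if "l < n" for l
    using alg_indep_var_nonzero[OF emb x that] .
  have C: "is_subring ?C"
    by (rule is_subring_laurent[OF emb]) (use x0 in auto)
  have "w = (\<Prod>l\<in>{..<n} - {j}. inverse (x l) ^ hat_exp F j l)"
    by (simp add: w_def power_inverse prod_inversef[symmetric] comp_def)
  also have "\<dots> \<in> ?C"
    by (intro is_subring_prod[OF C] is_subringD[OF C] laurent_var_inverse[OF emb]) auto
  finally have "w \<in> ?C" .
  moreover have "inverse w \<in> ?C"
    unfolding w_def inverse_inverse_eq
    by (intro is_subring_prod[OF C] is_subringD[OF C] laurent_var[OF emb]) auto
  moreover have "hatF emb n x F j / x j = w * (meval emb x (F j) / x j)"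
    by (simp add: hatF_def w_def divide_inverse mult_ac)
  ultimately show ?thesis
    using laurent_scale[OF emb, of "{..<n}" j x "meval emb x (F j) / x j" w] x0 nz \<open>j < n\<close>
    by (simp add: w_def)
qed

section \<open>Equality of the upper bounds\<close>

theorem theorem4p8:
  fixes emb :: "'a::{factorial_semiring, idom, ring_char_0} \<Rightarrow> 'k::field"
    and n k :: nat and x x' :: "nat \<Rightarrow> 'k" and F F' :: "nat \<Rightarrow> 'a mpoly"
  assumes "ring_emb emb"
    and "rational_function_field emb n"
    and "LP_seed emb n x F"
    and "\<forall>j<n. hatF emb n x F j = meval emb x (F j)"
    and "k < n"
    and "LP_mutation emb n k x F x' F'"
  shows "upper_bound emb n x F = upper_bound emb n x' F'"
proof -
  have emb: "ring_hom emb"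
    using assms(1) by (rule ring_emb_imp_ring_hom)
  note hom = ring_homD[OF ring_hom_meval[OF emb]]
  have x: "alg_indep emb n x"
    using assms(3) by (simp add: LP_seed_def transcendence_basis_def)
  have F: "F i \<in> mpolys ({..<n} - {i})" "irreducible (F i)" "F i \<noteq> 0" "\<And>l. \<not> Var l dvd F i" if "i < n" for i
    using assms(3) that by (auto simp: LP_seed_def mpolys_def irreducible_def)
  have Fx: "meval emb x (F i) \<noteq> 0" if "i < n" for i
    using alg_indep_nonzero[OF emb x mpolys_mono[OF Diff_subset F(1)[OF that]] F(3)[OF that]] .
  \<comment> \<open>Equality of \<open>hatF\<close> with the value of \<open>F i\<close> makes the
    denominator 1, and algebraic independence then makes every exponent 0.\<close>
  have hat0: "hat_exp F i l = 0" if "i < n" "l < n" "l \<noteq> i" for i l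
  proof -
    let ?m = "\<Prod>l\<in>{..<n} - {i}. x l ^ hat_exp F i l"
    have "meval emb x (F i) / ?m = meval emb x (F i)"
      using assms(4) that by (simp add: hatF_def)
    then have "?m = 1"
      using Fx[OF that(1)] by (metis divide_eq_0_iff divide_self_if divide_divide_eq_right nonzero_mult_div_cancel_left)
    then have "meval emb x (\<Prod>l\<in>{..<n} - {i}. Var l ^ hat_exp F i l) = meval emb x 1"
      by (simp add: meval_monomial[OF emb] hom)
    then have "(\<Prod>l\<in>{..<n} - {i}. Var l ^ hat_exp F i l) = (1 :: 'a mpoly)"
      by (intro alg_indep_inject[OF emb x] monomial_in_mpolys) (auto simp: mpolys_closed)
    then show ?thesis
      using that by (intro monomial_eq_1_imp) auto
  qed
  have x': "x' = x(k := meval emb x (F k) / x k)"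
    using assms by (simp add: LP_mutation_def)
  have ai': "alg_indep emb n x'"
    unfolding x' by (rule alg_indep_exchange[OF emb x \<open>k < n\<close> F(1,3)[OF \<open>k < n\<close>]])
  have nz: "x l \<noteq> 0" "x' l \<noteq> 0" if "l < n" for l
    using alg_indep_var_nonzero[OF emb x that] alg_indep_var_nonzero[OF emb ai' that] .
  \<comment> \<open>\<open>F k\<close> is unchanged and free of x_k, so exchanging the new variable
    gives x_k back.\<close>
  have dir_k: "laurent emb {..<n} (x'(k := hatF emb n x' F' k / x' k)) = laurent emb {..<n} x"
  proof -
    have "meval emb x' (F' k) = meval emb x (F k)"
      using assms(6) F(1)[OF \<open>k < n\<close>] meval_upd_not_in_vars[OF not_in_mpolys_Diff]
      by (simp add: LP_mutation_def x')
    moreover from this have "x'(k := meval emb x' (F' k) / x' k) = x"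
      using nz[OF \<open>k < n\<close>] Fx[OF \<open>k < n\<close>] by (auto simp: x')
    ultimately show ?thesis
      using laurent_hatF[OF emb ai' \<open>k < n\<close>, of F'] Fx[OF \<open>k < n\<close>] by simp
  qed
  \<comment> \<open>Both upper bounds lie in the Laurent rings of \<open>x\<close> and
    \<open>x'\<close>, so the other directions are compared only on the intersection of these two
    rings.\<close>
  have dir_j: "y \<in> laurent emb {..<n} (x(j := meval emb x (F j) / x j)) \<longleftrightarrow>
      y \<in> laurent emb {..<n} (x'(j := hatF emb n x' F' j / x' j))"
    if j: "j < n" "j \<noteq> k" and y: "y \<in> laurent emb {..<n} x" "y \<in> laurent emb {..<n} x'" for j y
  proof (cases "k \<in> vars (F j)")
    case True
    then have "mut_poly emb n k j x F x' (F' j)"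
      using assms(6) j unfolding LP_mutation_def by blast
    then obtain D w where D: "D \<in> mpolys ({..<n} - {j, k})" "D \<noteq> 0"
      and w: "w \<in> laurent emb ({..<n} - {j}) x'" "inverse w \<in> laurent emb ({..<n} - {j}) x'" "w \<noteq> 0"
        "meval emb x' (F' j) * meval emb x D =
          w * meval emb (x(k := meval emb x (cf j (F k) 0) / x' k)) (F j)"
      and Q': "F' j \<in> mpolys ({..<n} - {j})" "F' j \<noteq> 0" "\<And>l. \<not> Var l dvd F' j"
      and coprime': "\<And>m z. F' j ^ m dvd cf j (F k) 0 * z \<Longrightarrow> F' j ^ m dvd z"
      using mut_polyE[OF emb x j(1) \<open>k < n\<close> j(2) F(1,3)[OF \<open>k < n\<close>] F(4)[OF \<open>k < n\<close>]
          hat0[OF \<open>k < n\<close>] x' F(1)[OF j(1)]] by metis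
    \<comment> \<open>\<open>F j\<close> involves x_k while \<open>D\<close> does not.\<close>
    have "\<not> F j dvd D"
      using dvd_imp_vars_subset[OF _ D(2)] True D(1) by (auto simp: mpolys_def)
    moreover have "\<not> F j dvd cf j (F k) 0"
      using hat_exp_eq_0_imp_not_dvd[of F k j] hat0 F j \<open>k < n\<close> by auto
    ultimately have "\<not> F j dvd cf j (F k) 0 * D"
      using prime_elem_dvd_multD[OF irreducible_imp_prime_elem_mpoly[OF F(2)[OF j(1)]]] by blast
    then have coprime: "F j ^ m dvd z" if "F j ^ m dvd cf j (F k) 0 * D * z" for m z
      using irreducible_power_dvd_cancel[OF F(2)[OF j(1)] _ that] by blast
    have F'x': "meval emb x' (F' j) \<noteq> 0"
      using alg_indep_nonzero[OF emb ai' mpolys_mono[OF Diff_subset Q'(1)] Q'(2)] .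
    show ?thesis
      unfolding laurent_hatF[of emb n x' j F', OF emb ai' j(1) F'x']
      using coprime coprime'
      by (intro exchanged_laurent_mutation[OF emb x j(1) \<open>k < n\<close> j(2) F(1,3)[OF \<open>k < n\<close>] x'
            F(1,3,4)[OF j(1)] Q' D _ _ w y]) blast+
  next
    case False
    then obtain u where u: "u dvd 1" "F' j = Const u * F j"
      using assms(6) j by (auto simp: LP_mutation_def)
    obtain v where v: "inverse (emb u) = emb v" "emb u \<noteq> 0"
      using emb_unit[OF emb u(1)] by blast
    have Fx': "meval emb x' (F j) = meval emb x (F j)"
      unfolding x' by (rule meval_upd_not_in_vars[OF False])
    have F'x': "meval emb x' (F' j) = emb u * meval emb x' (F j)"
      by (simp add: u hom meval_Const[OF emb])
    have coprime: "F j ^ m dvd z" if "F j ^ m dvd cf j (F k) 0 * z" for m z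
    proof (rule irreducible_power_dvd_cancel[OF F(2)[OF j(1)] _ that])
      show "\<not> F j dvd cf j (F k) 0"
        using hat_exp_eq_0_imp_not_dvd[of F k j] hat0 F j \<open>k < n\<close> by auto
    qed
    \<comment> \<open>The unit constant by which \<open>F' j\<close> differs from \<open>F j\<close>
      is absorbed in the exchanged variable.\<close>
    have "laurent emb {..<n} (x'(j := hatF emb n x' F' j / x' j)) =
        laurent emb {..<n} (x'(j := emb u * (meval emb x' (F j) / x' j)))"
      using laurent_hatF[OF emb ai' j(1), of F'] v Fx[OF j(1)] by (simp add: F'x' Fx')
    also have "\<dots> = laurent emb {..<n} (x'(j := meval emb x' (F j) / x' j))"
      by (rule laurent_scale[OF emb])
         (use nz v Fx[OF j(1)] j laurent_const[OF emb] in \<open>auto simp: Fx'\<close>)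
    finally have *: "laurent emb {..<n} (x'(j := hatF emb n x' F' j / x' j)) = \<dots>" .
    have one: "1 \<in> laurent emb ({..<n} - {j}) x'" "inverse 1 \<in> laurent emb ({..<n} - {j}) x'"
      using laurent_const[OF emb, of 1] by (simp_all add: ring_homD[OF emb])
    \<comment> \<open>\<open>F j\<close> itself serves as the mutated polynomial; no factor is
      removed, so \<open>D\<close> and \<open>w\<close> are 1.\<close>
    show ?thesis
      unfolding *
    proof (rule exchanged_laurent_mutation[OF emb x j(1) \<open>k < n\<close> j(2) F(1,3)[OF \<open>k < n\<close>] x'
          F(1,3,4)[OF j(1)] F(1,3,4)[OF j(1)] mpolys_closed(2) one_neq_zero _ _ one one_neq_zero _ y])
      show "F j ^ m dvd z" if "F j ^ m dvd cf j (F k) 0 * 1 * z" for m z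
        using that unfolding mult_1_right by (rule coprime)
      show "F j ^ m dvd z" if "F j ^ m dvd cf j (F k) 0 * z" for m z
        using that by (rule coprime)
      show "meval emb x' (F j) * meval emb x 1 =
          1 * meval emb (x(k := meval emb x (cf j (F k) 0) / x' k)) (F j)"
        by (simp add: hom Fx' meval_upd_not_in_vars[OF False])
    qed
  qed
  \<comment> \<open>In direction \<open>k\<close> the exchanged ring of each seed is the Laurent
    ring of the other.\<close>
  have U: "upper_bound emb n x F = laurent emb {..<n} x \<inter> laurent emb {..<n} x' \<inter>
      (\<Inter>j\<in>{..<n} - {k}. laurent emb {..<n} (x(j := meval emb x (F j) / x j)))"
    using assms(4) \<open>k < n\<close> by (auto simp: upper_bound_def x')
  have U': "upper_bound emb n x' F' = laurent emb {..<n} x \<inter> laurent emb {..<n} x' \<inter>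
      (\<Inter>j\<in>{..<n} - {k}. laurent emb {..<n} (x'(j := hatF emb n x' F' j / x' j)))"
    unfolding upper_bound_def using dir_k \<open>k < n\<close> by blast
  show ?thesis
    unfolding U U' using dir_j by blast
qed

end
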